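(* Every germ at the origin of a hyperbolic $C^1$ vector field on the real line is contained in a $C^1$-continuous path of germs of hyperbolic $C^1$ vector fields, all having the same multiplier at the origin, and such that the time-$1$ maps of their flows are pairwise bi-Lipschitz conjugate though pairwise non $C^1$-conjugate (for distinct parameters of the path).
   Context: All germs are germs at $0$ of vector fields (resp. diffeomorphisms) on the real line having a singularity (resp. fixed point) at the origin. For a germ of $C^1$ vector field $X$ with $X(0)=0$, its multiplier is $\lambda := DX(0)$; $X$ is hyperbolic if $\lambda\neq 0$. The time-$1$ map is the germ at $0$ of the time-$1$ map of the flow of $X$. Germs of diffeomorphisms $f,g$ fixing $0$ are conjugate by a germ of homeomorphism $h$ fixing $0$ if $hfh^{-1}=g$ near $0$; they are bi-Lipschitz conjugate (resp. $C^1$-conjugate) if $h$ can be chosen bi-Lipschitz (resp. a $C^1$ diffeomorphism) on a neighborhood of $0$. A $C^1$-continuous path of germs is a family $(X_\alpha)_{\alpha\in I}$ indexed by a nondegenerate interval $I\subset\mathbb{R}$, having representatives defined on a common neighborhood $[-\delta,\delta]$ of $0$ that depend continuously on $\alpha$ in the $C^1$ topology on $[-\delta,\delta]$. *)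

theory Defs
  imports "HOL-Analysis.Analysis"
begin

text \<open>
  Germs at \<open>0\<close> are represented by total functions \<open>real \<Rightarrow> real\<close>. Every notion below depends only
  on the values near \<open>0\<close>, except \<open>C1_continuous_path\<close>, which speaks about representatives on a
  common neighbourhood, as it must.
\<close>

definition C1_vector_field_germ :: "(real \<Rightarrow> real) \<Rightarrow> bool" where
  "C1_vector_field_germ X \<longleftrightarrow> X 0 = 0 \<and> (\<exists>\<epsilon>>0. X C1_differentiable_on {-\<epsilon><..<\<epsilon>})"

definition multiplier :: "(real \<Rightarrow> real) \<Rightarrow> real" where
  "multiplier X = deriv X 0"

definition hyperbolic_germ :: "(real \<Rightarrow> real) \<Rightarrow> bool" where
  "hyperbolic_germ X \<longleftrightarrow> C1_vector_field_germ X \<and> multiplier X \<noteq> 0"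

text \<open>
  \<open>f\<close> represents the germ of the time-\<open>1\<close> map of the flow of \<open>X\<close>. The integral curves are required
  to stay in an arbitrarily small neighbourhood of \<open>0\<close>, so that the values of \<open>X\<close> away from \<open>0\<close>
  play no role. For a \<open>C\<^sup>1\<close> germ vanishing at \<open>0\<close> such an \<open>f\<close> exists and is unique as a germ.
\<close>

definition is_time_one_map :: "(real \<Rightarrow> real) \<Rightarrow> (real \<Rightarrow> real) \<Rightarrow> bool" where
  "is_time_one_map X f \<longleftrightarrow>
     (\<forall>\<epsilon>>0. \<forall>\<^sub>F x in nhds 0.
        \<exists>c. c 0 = x \<and> c 1 = f x \<and>
            (\<forall>t\<in>{0..1}. c t \<in> {-\<epsilon><..<\<epsilon>} \<and>
                        (c has_vector_derivative X (c t)) (at t within {0..1})))"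

text \<open>
  The germ of the homeomorphism \<open>h\<close>, with inverse \<open>k\<close>, fixes \<open>0\<close> and conjugates \<open>f\<close> to \<open>g\<close>.
  Orientation-reversing \<open>h\<close> are allowed.
\<close>

definition germ_conjugacy ::
  "real set \<Rightarrow> real set \<Rightarrow> (real \<Rightarrow> real) \<Rightarrow> (real \<Rightarrow> real) \<Rightarrow>
   (real \<Rightarrow> real) \<Rightarrow> (real \<Rightarrow> real) \<Rightarrow> bool" where
  "germ_conjugacy U V h k f g \<longleftrightarrow>
     open U \<and> open V \<and> 0 \<in> U \<and> 0 \<in> V \<and> homeomorphism U V h k \<and> h 0 = 0 \<and>
     (\<forall>\<^sub>F y in nhds 0. h (f (k y)) = g y)"

definition bilipschitz_conjugate :: "(real \<Rightarrow> real) \<Rightarrow> (real \<Rightarrow> real) \<Rightarrow> bool" where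
  "bilipschitz_conjugate f g \<longleftrightarrow>
     (\<exists>U V h k L M. germ_conjugacy U V h k f g \<and> L-lipschitz_on U h \<and> M-lipschitz_on V k)"

definition C1_conjugate :: "(real \<Rightarrow> real) \<Rightarrow> (real \<Rightarrow> real) \<Rightarrow> bool" where
  "C1_conjugate f g \<longleftrightarrow>
     (\<exists>U V h k. germ_conjugacy U V h k f g \<and>
        h C1_differentiable_on U \<and> k C1_differentiable_on V)"

definition C1_continuous_path :: "real set \<Rightarrow> (real \<Rightarrow> real \<Rightarrow> real) \<Rightarrow> bool" where
  "C1_continuous_path I X \<longleftrightarrow>
     is_interval I \<and> (\<exists>a\<in>I. \<exists>b\<in>I. a < b) \<and>
     (\<exists>\<delta>>0.
        (\<forall>\<alpha>\<in>I. X \<alpha> C1_differentiable_on {-\<delta>..\<delta>}) \<and>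
        (\<forall>\<alpha>\<in>I. uniform_limit {-\<delta>..\<delta>} X (X \<alpha>) (at \<alpha> within I) \<and>
               uniform_limit {-\<delta>..\<delta>} (\<lambda>\<beta>. deriv (X \<beta>)) (deriv (X \<alpha>)) (at \<alpha> within I)))"

end

theory Submission
  imports Defs "HOL-Real_Asymp.Real_Asymp"
begin

text \<open>
  Write \<open>X\<^sub>0 x = \<kappa> x / p x\<close> with \<open>p\<close> continuous and \<open>p 0 = 1\<close>, so that
  \<open>\<kappa>\<close> times the time coordinate of the flow is a function \<open>L\<close> with \<open>L' x = p x / x\<close>, and the flow
  is translation in \<open>L\<close>. Perturb \<open>L\<close> to \<open>L + \<alpha> w\<close>, where \<open>w x = sin (ln (1 + (ln \<bar>x\<bar>)\<^sup>2)) / 4\<close> is bounded,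
  has no limit at \<open>0\<close>, and satisfies \<open>x w' x \<longrightarrow> 0\<close> and \<open>x\<^sup>2 w'' x \<longrightarrow> 0\<close>; the latter two properties
  keep the vector field \<open>C\<^sup>1\<close> with multiplier \<open>\<kappa>\<close>. Since the time coordinates differ by a bounded
  function, matching them gives a bi-Lipschitz conjugacy.

  Conversely, for a conjugacy \<open>h\<close> of the time-one maps that is differentiable at \<open>0\<close> with
  \<open>\<mu> = h' 0 \<noteq> 0\<close>, the difference \<open>L\<^sub>\<beta> (h x) - L\<^sub>\<alpha> x\<close> is invariant under the time-one map
  and varies slowly at \<open>0\<close>, hence is constant on each side of \<open>0\<close>. Up to a convergent term it equals
  \<open>W\<^sub>\<beta> (\<plusminus>x) - W\<^sub>\<alpha> x\<close> with \<open>W x = L x - ln \<bar>x\<bar>\<close>. Adding the values at \<open>x\<close> and \<open>-x\<close> cancels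
  the contribution of \<open>X\<^sub>0\<close>, whatever the sign of \<open>\<mu>\<close>, and leaves \<open>2 (\<beta> - \<alpha>) w x\<close>, which
  would have to converge.
\<close>

subsection \<open>Time coordinates of a hyperbolic singularity\<close>

text \<open>In \<open>time_inv L \<sigma> u\<close> only the sign of \<open>\<sigma>\<close> matters: it selects the half-line on which \<open>L\<close> is inverted.\<close>

definition time_inv :: "(real \<Rightarrow> real) \<Rightarrow> real \<Rightarrow> real \<Rightarrow> real" where
  "time_inv L \<sigma> u = (THE y. 0 < \<sigma> * y \<and> L y = u)"

text \<open>The time-\<open>d\<close> map of the flow of \<open>x / p x\<close> when
  \<open>L\<close> has derivative \<open>p x / x\<close>. Passing \<open>x\<close> itself as the
  selector keeps every orbit on its own side of the singularity.\<close>

definition time_shift :: "(real \<Rightarrow> real) \<Rightarrow> real \<Rightarrow> real \<Rightarrow> real" where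
  "time_shift L d x = (if x = 0 then 0 else time_inv L x (L x + d))"

text \<open>Karamata's slow variation at 0, written additively and with uniformity over bounded
  logarithmic distances built in. The condition \<open>0 < x * y\<close> treats the two sides of 0
  separately.\<close>

definition slowly_varying :: "(real \<Rightarrow> real) \<Rightarrow> bool" where
  "slowly_varying W \<longleftrightarrow> (\<forall>\<epsilon>>0. \<forall>R. \<exists>\<delta>>0. \<forall>x y. 0 < x * y \<longrightarrow> \<bar>x\<bar> < \<delta> \<longrightarrow> \<bar>y\<bar> < \<delta> \<longrightarrow>
      \<bar>ln \<bar>x\<bar> - ln \<bar>y\<bar>\<bar> \<le> R \<longrightarrow> \<bar>W x - W y\<bar> \<le> \<epsilon>)"

lemma same_sign_exp:
  fixes x y :: real
  assumes "0 < x * y"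
  shows "y = x * exp (ln \<bar>y\<bar> - ln \<bar>x\<bar>)"
  using assms by (auto simp: exp_diff zero_less_mult_iff)

lemma same_sign_trans:
  fixes x y z :: real
  shows "0 < x * y \<Longrightarrow> 0 < y * z \<Longrightarrow> 0 < x * z"
  by (auto simp: zero_less_mult_iff)

lemma slowly_varyingD:
  assumes "slowly_varying W" "0 < \<epsilon>"
  obtains \<delta> where "0 < \<delta>" "\<And>x y. 0 < x * y \<Longrightarrow> \<bar>x\<bar> < \<delta> \<Longrightarrow> \<bar>y\<bar> < \<delta> \<Longrightarrow>
      \<bar>ln \<bar>x\<bar> - ln \<bar>y\<bar>\<bar> \<le> R \<Longrightarrow> \<bar>W x - W y\<bar> \<le> \<epsilon>"
  using assms unfolding slowly_varying_def by meson

lemma slowly_varying_diff: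
  assumes "slowly_varying V" "slowly_varying W"
  shows "slowly_varying (\<lambda>x. V x - W x)"
  unfolding slowly_varying_def
proof (intro allI impI)
  fix \<epsilon> R :: real assume "0 < \<epsilon>"
  then have e2: "0 < \<epsilon> / 2" by simp
  obtain d1 where d1: "0 < d1" "\<And>x y. 0 < x * y \<Longrightarrow> \<bar>x\<bar> < d1 \<Longrightarrow> \<bar>y\<bar> < d1 \<Longrightarrow>
      \<bar>ln \<bar>x\<bar> - ln \<bar>y\<bar>\<bar> \<le> R \<Longrightarrow> \<bar>V x - V y\<bar> \<le> \<epsilon> / 2"
    using slowly_varyingD[OF assms(1) e2] by metis
  obtain d2 where d2: "0 < d2" "\<And>x y. 0 < x * y \<Longrightarrow> \<bar>x\<bar> < d2 \<Longrightarrow> \<bar>y\<bar> < d2 \<Longrightarrow>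
      \<bar>ln \<bar>x\<bar> - ln \<bar>y\<bar>\<bar> \<le> R \<Longrightarrow> \<bar>W x - W y\<bar> \<le> \<epsilon> / 2"
    using slowly_varyingD[OF assms(2) e2] by metis
  show "\<exists>\<delta>>0. \<forall>x y. 0 < x * y \<longrightarrow> \<bar>x\<bar> < \<delta> \<longrightarrow> \<bar>y\<bar> < \<delta> \<longrightarrow>
      \<bar>ln \<bar>x\<bar> - ln \<bar>y\<bar>\<bar> \<le> R \<longrightarrow> \<bar>(V x - W x) - (V y - W y)\<bar> \<le> \<epsilon>"
  proof (intro exI[of _ "min d1 d2"] conjI allI impI)
    show "0 < min d1 d2" using d1(1) d2(1) by simp
  next
    fix x y :: real
    assume "0 < x * y" "\<bar>x\<bar> < min d1 d2" "\<bar>y\<bar> < min d1 d2" "\<bar>ln \<bar>x\<bar> - ln \<bar>y\<bar>\<bar> \<le> R"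
    then have "\<bar>V x - V y\<bar> \<le> \<epsilon> / 2" "\<bar>W x - W y\<bar> \<le> \<epsilon> / 2" using d1(2)[of x y] d2(2)[of x y] by auto
    then show "\<bar>(V x - W x) - (V y - W y)\<bar> \<le> \<epsilon>" by linarith
  qed
qed

lemma slowly_varying_reflect:
  assumes "slowly_varying W" "\<bar>\<tau>\<bar> = 1"
  shows "slowly_varying (\<lambda>x. W (\<tau> * x))"
proof -
  have *: "\<bar>\<tau> * x\<bar> = \<bar>x\<bar>" "(\<tau> * x) * (\<tau> * y) = x * y" for x y
    using assms(2) by (auto simp: abs_mult abs_if split: if_splits)
  show ?thesis
    using assms(1) unfolding slowly_varying_def by (metis *)
qed

lemma tendsto_imp_slowly_varying:
  assumes "(f \<longlongrightarrow> l) (at 0)"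
  shows "slowly_varying f"
  unfolding slowly_varying_def
proof (intro allI impI)
  fix \<epsilon> R :: real assume "0 < \<epsilon>"
  then obtain d where d: "0 < d" "\<And>x. x \<noteq> 0 \<Longrightarrow> \<bar>x\<bar> < d \<Longrightarrow> \<bar>f x - l\<bar> < \<epsilon> / 2"
    using LIM_D[OF assms, of "\<epsilon> / 2"] by (auto)
  show "\<exists>\<delta>>0. \<forall>x y. 0 < x * y \<longrightarrow> \<bar>x\<bar> < \<delta> \<longrightarrow> \<bar>y\<bar> < \<delta> \<longrightarrow>
      \<bar>ln \<bar>x\<bar> - ln \<bar>y\<bar>\<bar> \<le> R \<longrightarrow> \<bar>f x - f y\<bar> \<le> \<epsilon>"
  proof (intro exI[of _ d] conjI allI impI d(1))
    fix x y :: real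
    assume "0 < x * y" "\<bar>x\<bar> < d" "\<bar>y\<bar> < d"
    then have "\<bar>f x - l\<bar> < \<epsilon> / 2" "\<bar>f y - l\<bar> < \<epsilon> / 2" by (metis d(2) mult_eq_0_iff less_irrefl)+
    then show "\<bar>f x - f y\<bar> \<le> \<epsilon>" by linarith
  qed
qed

section \<open>Inversion of the time coordinate, and the flow as a translation\<close>

locale time_coordinate =
  fixes p L :: "real \<Rightarrow> real" and m M :: real
  assumes m_pos: "0 < m"
    and p_bounds: "\<And>x. x \<noteq> 0 \<Longrightarrow> m \<le> p x \<and> p x \<le> M"
    and p_tendsto: "(p \<longlongrightarrow> 1) (at 0)"
    and L_deriv: "\<And>x. x \<noteq> 0 \<Longrightarrow> (L has_real_derivative p x / x) (at x)"
begin

text \<open>The logarithmic coordinate \<open>s\<close> removes the pole: the factor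
  \<open>\<sigma> * exp s\<close> from the chain rule cancels the denominator.\<close>

lemma L_exp_deriv:
  assumes "\<sigma> \<noteq> 0"
  shows "((\<lambda>s. L (\<sigma> * exp s)) has_real_derivative p (\<sigma> * exp s)) (at s)"
proof -
  have "((\<lambda>s. L (\<sigma> * exp s)) has_real_derivative (p (\<sigma> * exp s) / (\<sigma> * exp s)) * (\<sigma> * exp s)) (at s)"
    using assms by (intro DERIV_chain2[OF L_deriv]) (auto intro!: derivative_eq_intros)
  then show ?thesis using assms by simp
qed

text \<open>Mean value theorem with slope at least \<open>m\<close>. The monotonicity and
  surjectivity of \<open>L\<close> and the estimate \<open>ln_dist_le\<close> all come from
  it.\<close>

lemma L_exp_lower:
  assumes "\<sigma> \<noteq> 0" "s \<le> t"
  shows "m * (t - s) \<le> L (\<sigma> * exp t) - L (\<sigma> * exp s)"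
proof (cases "s = t")
  case False
  then have "s < t" using assms by simp
  obtain z where "L (\<sigma> * exp t) - L (\<sigma> * exp s) = (t - s) * p (\<sigma> * exp z)"
    using MVT2[OF \<open>s < t\<close>, of "\<lambda>s. L (\<sigma> * exp s)" "\<lambda>s. p (\<sigma> * exp s)"] L_exp_deriv[OF assms(1)] by blast
  moreover have "m \<le> p (\<sigma> * exp z)" using p_bounds[of "\<sigma> * exp z"] assms by simp
  ultimately show ?thesis using \<open>s < t\<close> by (simp add: mult.commute)
qed simp

lemma ln_dist_le:
  assumes "0 < x * y"
  shows "m * \<bar>ln \<bar>x\<bar> - ln \<bar>y\<bar>\<bar> \<le> \<bar>L x - L y\<bar>"
proof -
  have x: "x \<noteq> 0" and y: "y = x * exp (ln \<bar>y\<bar> - ln \<bar>x\<bar>)"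
    using assms same_sign_exp[of x y] by auto
  show ?thesis
  proof (cases "ln \<bar>x\<bar> \<le> ln \<bar>y\<bar>")
    case True
    then show ?thesis
      using L_exp_lower[OF x, of 0 "ln \<bar>y\<bar> - ln \<bar>x\<bar>"] y by (simp add: abs_if)
  next
    case False
    then show ?thesis
      using L_exp_lower[OF x, of "ln \<bar>y\<bar> - ln \<bar>x\<bar>" 0] y by (simp add: abs_if)
  qed
qed

lemma L_strict_mono:
  assumes "0 < x * y" "\<bar>x\<bar> < \<bar>y\<bar>"
  shows "L x < L y"
proof -
  have x: "x \<noteq> 0" "y \<noteq> 0" and y: "y = x * exp (ln \<bar>y\<bar> - ln \<bar>x\<bar>)"
    using assms same_sign_exp[of x y] by auto
  have *: "ln \<bar>x\<bar> < ln \<bar>y\<bar>" using assms x by simp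
  then have "0 < m * (ln \<bar>y\<bar> - ln \<bar>x\<bar>)" using m_pos by simp
  then show ?thesis using L_exp_lower[OF x(1), of 0 "ln \<bar>y\<bar> - ln \<bar>x\<bar>"] y * by simp
qed

lemma L_inj:
  assumes "0 < x * y" "L x = L y"
  shows "x = y"
proof -
  have "\<not> \<bar>x\<bar> < \<bar>y\<bar>" "\<not> \<bar>y\<bar> < \<bar>x\<bar>"
    using L_strict_mono[of x y] L_strict_mono[of y x] assms by (auto simp: mult.commute)
  then show ?thesis using assms by (auto simp: abs_if zero_less_mult_iff split: if_splits)
qed

lemma L_surj:
  assumes "\<sigma> \<noteq> 0"
  shows "\<exists>y. 0 < \<sigma> * y \<and> L y = u"
proof -
  \<comment> \<open>Since the slope is at least \<open>m\<close>, moving a logarithmic distance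
    \<open>R\<close> from \<open>\<sigma>\<close> in either direction is enough to reach or pass the
    value \<open>u\<close>.\<close>
  define R where "R = \<bar>u - L \<sigma>\<bar> / m"
  have R: "0 \<le> R" "m * R = \<bar>u - L \<sigma>\<bar>" using m_pos by (auto simp: R_def)
  have 1: "L (\<sigma> * exp (-R)) \<le> u" using L_exp_lower[OF assms, of "-R" 0] R by simp
  have 2: "u \<le> L (\<sigma> * exp R)" using L_exp_lower[OF assms, of 0 R] R by simp
  have "\<exists>s\<ge>-R. s \<le> R \<and> L (\<sigma> * exp s) = u"
    using 1 2 R L_exp_deriv[OF assms] by (intro IVT) (auto intro: DERIV_isCont)
  then obtain s where "L (\<sigma> * exp s) = u" by blast
  moreover have "0 < \<sigma> * (\<sigma> * exp s)"
    using assms by (auto simp: zero_less_mult_iff mult_less_0_iff)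
  ultimately show ?thesis by blast
qed

lemma time_inv_props:
  assumes "\<sigma> \<noteq> 0"
  shows "0 < \<sigma> * time_inv L \<sigma> u" "L (time_inv L \<sigma> u) = u"
proof -
  obtain y where "0 < \<sigma> * y \<and> L y = u" using L_surj[OF assms] by blast
  then have "0 < \<sigma> * time_inv L \<sigma> u \<and> L (time_inv L \<sigma> u) = u"
    unfolding time_inv_def
    by (rule theI) (metis L_inj same_sign_trans mult.commute \<open>0 < \<sigma> * y \<and> L y = u\<close>)
  then show "0 < \<sigma> * time_inv L \<sigma> u" "L (time_inv L \<sigma> u) = u" by auto
qed

lemma time_inv_nonzero: "\<sigma> \<noteq> 0 \<Longrightarrow> time_inv L \<sigma> u \<noteq> 0"
  using time_inv_props(1)[of \<sigma> u] by auto

lemma time_inv_eqI: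
  assumes "0 < \<sigma> * y" "L y = u"
  shows "time_inv L \<sigma> u = y"
proof -
  have "\<sigma> \<noteq> 0" using assms by auto
  then show ?thesis
    using time_inv_props[of \<sigma> u] assms by (metis L_inj same_sign_trans mult.commute)
qed

lemma time_inv_cong: "0 < \<sigma> * \<tau> \<Longrightarrow> time_inv L \<sigma> u = time_inv L \<tau> u"
  using time_inv_props[of \<tau> u] by (cases "\<tau> = 0"; intro time_inv_eqI) (auto intro: same_sign_trans[of \<sigma> \<tau>])

text \<open>Inverse function theorem on one half-line. The formula says that
  \<open>time_inv L \<sigma>\<close> is an integral curve of the field
  \<open>x / p x\<close>.\<close>

lemma time_inv_deriv:
  assumes "\<sigma> \<noteq> 0"
  shows "(time_inv L \<sigma> has_real_derivative time_inv L \<sigma> u / p (time_inv L \<sigma> u)) (at u)"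
proof -
  let ?y = "time_inv L \<sigma> u"
  let ?S = "{y. 0 < \<sigma> * y}"
  have y: "?y \<in> ?S" "?y \<noteq> 0" "L ?y = u"
    using time_inv_props[OF assms] time_inv_nonzero[OF assms] by auto
  have nz: "z \<noteq> 0" if "z \<in> ?S" for z using that by auto
  have "(time_inv L \<sigma> has_field_derivative inverse (p ?y / ?y)) (at (L ?y))"
    unfolding has_field_derivative_def
  proof (rule has_derivative_inverse_strong[where S = ?S and f = L and x = ?y])
    show "(L has_derivative (*) (p ?y / ?y)) (at ?y)"
      using L_deriv[OF y(2)] by (simp add: has_field_derivative_def)
    have "p ?y / ?y \<noteq> 0" using p_bounds[of ?y] y m_pos by auto
    then show "(*) (p ?y / ?y) \<circ> (*) (inverse (p ?y / ?y)) = id" by (simp add: fun_eq_iff)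
    show "open ?S" by (intro open_Collect_less continuous_intros)
    show "?y \<in> ?S" by (rule y)
    show "continuous_on ?S L"
      using nz by (intro continuous_at_imp_continuous_on ballI DERIV_isCont[OF L_deriv])
    show "\<And>z. z \<in> ?S \<Longrightarrow> time_inv L \<sigma> (L z) = z"
      by (auto intro: time_inv_eqI)
  qed
  then show ?thesis using y by simp
qed

lemma time_shift_props:
  assumes "x \<noteq> 0"
  shows "0 < x * time_shift L d x" "L (time_shift L d x) = L x + d"
  using time_inv_props[OF assms] assms by (auto simp: time_shift_def)

text \<open>A time change \<open>d\<close> moves \<open>ln |x|\<close> by at most
  \<open>|d| / m\<close>. This confines integral curves of bounded duration to small neighbourhoods
  of 0.\<close>

lemma time_shift_bound: "\<bar>time_shift L d x\<bar> \<le> exp (\<bar>d\<bar> / m) * \<bar>x\<bar>"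
proof (cases "x = 0")
  case False
  let ?y = "time_shift L d x"
  have y: "0 < x * ?y" "L ?y = L x + d" using time_shift_props[OF False] by auto
  have "m * \<bar>ln \<bar>x\<bar> - ln \<bar>?y\<bar>\<bar> \<le> \<bar>d\<bar>" using ln_dist_le[OF y(1)] y(2) by simp
  then have "\<bar>ln \<bar>x\<bar> - ln \<bar>?y\<bar>\<bar> \<le> \<bar>d\<bar> / m" using m_pos by (simp add: field_simps)
  then have "ln \<bar>?y\<bar> \<le> ln \<bar>x\<bar> + \<bar>d\<bar> / m" by (simp add: abs_le_iff)
  then have "exp (ln \<bar>?y\<bar>) \<le> exp (ln \<bar>x\<bar> + \<bar>d\<bar> / m)" by simp
  moreover have "?y \<noteq> 0" using y(1) by auto
  ultimately show ?thesis using False by (simp add: exp_add mult.commute)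
qed (simp add: time_shift_def)

lemma is_time_one_map_time_shift:
  assumes X: "\<And>x. X x = \<kappa> * x / p x"
  shows "is_time_one_map X (time_shift L \<kappa>)"
  unfolding is_time_one_map_def
proof (intro allI impI)
  fix \<epsilon> :: real assume "0 < \<epsilon>"
  let ?K = "exp (\<bar>\<kappa>\<bar> / m)"
  \<comment> \<open>The factor \<open>?K\<close> bounds the expansion at all times up to 1, so a
    curve starting this close never leaves the prescribed neighbourhood.\<close>
  have "\<forall>\<^sub>F x in nhds 0. \<bar>x\<bar> < \<epsilon> / ?K"
    using \<open>0 < \<epsilon>\<close> by (auto simp: eventually_nhds_metric intro!: exI[of _ "\<epsilon> / ?K"])
  then show "\<forall>\<^sub>F x in nhds 0. \<exists>c. c 0 = x \<and> c 1 = time_shift L \<kappa> x \<and>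
      (\<forall>t\<in>{0..1}. c t \<in> {-\<epsilon><..<\<epsilon>} \<and> (c has_vector_derivative X (c t)) (at t within {0..1}))"
  proof eventually_elim
    case (elim x)
    let ?c = "\<lambda>t. time_shift L (\<kappa> * t) x"
    have c0: "?c 0 = x"
      by (cases "x = 0") (auto simp: time_shift_def zero_less_mult_iff intro!: time_inv_eqI)
    have "?c t \<in> {-\<epsilon><..<\<epsilon>}" if "t \<in> {0..1}" for t
    proof -
      have "\<bar>\<kappa> * t\<bar> \<le> \<bar>\<kappa>\<bar>" using that by (simp add: abs_mult mult_left_le)
      then have "exp (\<bar>\<kappa> * t\<bar> / m) \<le> ?K" using m_pos by (simp add: divide_right_mono)
      then have "\<bar>?c t\<bar> \<le> ?K * \<bar>x\<bar>"
        by (intro order_trans[OF time_shift_bound] mult_right_mono) auto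
      also have "\<dots> < \<epsilon>" using elim by (simp add: field_simps)
      finally show ?thesis by auto
    qed
    moreover have "(?c has_vector_derivative X (?c t)) (at t within {0..1})" for t
    proof (cases "x = 0")
      case False
      let ?y = "?c t"
      have y: "?y = time_inv L x (L x + \<kappa> * t)" using False by (simp add: time_shift_def)
      have "((\<lambda>t. time_inv L x (L x + \<kappa> * t)) has_real_derivative (?y / p ?y) * \<kappa>) (at t)"
        unfolding y using False
        by (intro DERIV_chain2[OF time_inv_deriv]) (auto intro!: derivative_eq_intros)
      then have "((\<lambda>t. time_inv L x (L x + \<kappa> * t)) has_vector_derivative X ?y) (at t within {0..1})"
        by (simp add: X has_real_derivative_iff_has_vector_derivative mult.commute
            has_vector_derivative_at_within)
      then show ?thesis using False by (simp add: time_shift_def)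
    qed (auto simp: time_shift_def X)
    ultimately show ?case using c0 by (intro exI[of _ ?c]) auto
  qed
qed

text \<open>In the logarithmic coordinate this difference has derivative \<open>p - 1\<close>, which
  tends to 0 at the singularity; over a bounded logarithmic distance the mean value theorem makes
  its variation small.\<close>

lemma slowly_varying_L: "slowly_varying (\<lambda>x. L x - ln \<bar>x\<bar>)"
  unfolding slowly_varying_def
proof (intro allI impI)
  fix \<epsilon> R :: real assume e: "0 < \<epsilon>"
  \<comment> \<open>Here \<open>R\<close> is an arbitrary real; the absolute value and the added 1
    keep the denominator positive even for \<open>R \<le> 0\<close>.\<close>
  define \<eta> where "\<eta> = \<epsilon> / (\<bar>R\<bar> + 1)"
  have eta: "0 < \<eta>" "\<eta> * \<bar>R\<bar> \<le> \<epsilon>" using e by (auto simp: \<eta>_def field_simps)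
  obtain d where d: "0 < d" "\<And>x. x \<noteq> 0 \<Longrightarrow> \<bar>x\<bar> < d \<Longrightarrow> \<bar>p x - 1\<bar> < \<eta>"
    using LIM_D[OF p_tendsto eta(1)] by auto
  have main: "\<bar>(L y - ln \<bar>y\<bar>) - (L x - ln \<bar>x\<bar>)\<bar> \<le> \<epsilon>"
    if xy: "0 < x * y" "\<bar>x\<bar> < d" "\<bar>y\<bar> < d" "\<bar>ln \<bar>x\<bar> - ln \<bar>y\<bar>\<bar> \<le> R" "\<bar>x\<bar> < \<bar>y\<bar>" for x y
  proof -
    have x: "x \<noteq> 0" "y \<noteq> 0" and y: "y = x * exp (ln \<bar>y\<bar> - ln \<bar>x\<bar>)"
      using xy same_sign_exp[of x y] by auto
    define t where "t = ln \<bar>y\<bar> - ln \<bar>x\<bar>"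
    have t: "0 < t" using xy x by (simp add: t_def)
    have "((\<lambda>s. L (x * exp s) - s) has_real_derivative p (x * exp s) - 1) (at s)" for s
      by (intro derivative_intros L_exp_deriv x)
    then obtain z where z: "0 < z" "z < t"
        "(L (x * exp t) - t) - (L (x * exp 0) - 0) = (t - 0) * (p (x * exp z) - 1)"
      using MVT2[OF t, of "\<lambda>s. L (x * exp s) - s" "\<lambda>s. p (x * exp s) - 1"] by blast
    \<comment> \<open>The intermediate point is no farther from 0 than \<open>y\<close>, so it still
      lies where \<open>p\<close> is close to 1.\<close>
    have "\<bar>x * exp z\<bar> \<le> \<bar>x * exp t\<bar>" using z by (simp add: abs_mult mult_left_mono)
    also have "\<dots> < d" using xy y by (simp add: t_def)
    finally have "\<bar>p (x * exp z) - 1\<bar> \<le> \<eta>" using d(2)[of "x * exp z"] x by simp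
    moreover have "\<bar>t\<bar> \<le> \<bar>R\<bar>" using xy t by (simp add: t_def)
    ultimately have "\<bar>t * (p (x * exp z) - 1)\<bar> \<le> \<bar>R\<bar> * \<eta>"
      unfolding abs_mult by (intro mult_mono) auto
    moreover have "L y - t - L x = t * (p (x * exp z) - 1)" using z(3) y by (simp add: t_def)
    ultimately have "\<bar>L y - t - L x\<bar> \<le> \<epsilon>" using eta(2) by (simp add: mult.commute)
    then show ?thesis by (simp add: t_def algebra_simps)
  qed
  show "\<exists>\<delta>>0. \<forall>x y. 0 < x * y \<longrightarrow> \<bar>x\<bar> < \<delta> \<longrightarrow> \<bar>y\<bar> < \<delta> \<longrightarrow>
      \<bar>ln \<bar>x\<bar> - ln \<bar>y\<bar>\<bar> \<le> R \<longrightarrow> \<bar>(L x - ln \<bar>x\<bar>) - (L y - ln \<bar>y\<bar>)\<bar> \<le> \<epsilon>"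
  proof (intro exI[of _ d] conjI allI impI d(1))
    fix x y :: real
    assume xy: "0 < x * y" "\<bar>x\<bar> < d" "\<bar>y\<bar> < d" "\<bar>ln \<bar>x\<bar> - ln \<bar>y\<bar>\<bar> \<le> R"
    consider "\<bar>x\<bar> < \<bar>y\<bar>" | "\<bar>y\<bar> < \<bar>x\<bar>" | "x = y"
      using xy(1) by (auto simp: zero_less_mult_iff abs_if split: if_splits) linarith+
    then show "\<bar>(L x - ln \<bar>x\<bar>) - (L y - ln \<bar>y\<bar>)\<bar> \<le> \<epsilon>"
    proof cases
      case 1
      from main[OF xy this] show ?thesis by linarith
    next
      case 2
      have "0 < y * x" "\<bar>ln \<bar>y\<bar> - ln \<bar>x\<bar>\<bar> \<le> R" using xy(1,4) by (simp_all only: mult.commute abs_minus_commute)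
      from main[OF this(1) xy(3,2) this(2) 2] show ?thesis .
    qed (use e in simp)
  qed
qed

end

subsection \<open>Conjugacies of time-one maps\<close>

context time_coordinate
begin

text \<open>In the time coordinate, approaching 0 means \<open>u\<close> tending to minus infinity,
  where \<open>f\<close> becomes a function \<open>e\<close> of period \<open>|\<kappa>|\<close>.
  Slow variation makes \<open>e\<close> nearly equal at two arguments far down, and periodicity
  carries this back to the original arguments.\<close>

lemma eventually_constant_of_time_shift_invariant:
  assumes sv: "slowly_varying f" and "\<kappa> \<noteq> 0" and "\<sigma> \<noteq> 0"
    and inv: "\<forall>\<^sub>F x in at 0. f (time_shift L \<kappa> x) = f x"
  shows "\<exists>c. \<exists>\<delta>>0. \<forall>x. 0 < \<sigma> * x \<longrightarrow> \<bar>x\<bar> < \<delta> \<longrightarrow> f x = c"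
proof -
  obtain \<delta> where \<delta>: "0 < \<delta>" "\<And>x. x \<noteq> 0 \<Longrightarrow> \<bar>x\<bar> < \<delta> \<Longrightarrow> f (time_shift L \<kappa> x) = f x"
    using inv by (auto simp: eventually_at)
  define e where "e u = f (time_inv L \<sigma> u)" for u
  \<comment> \<open>\<open>L\<close> increases away from 0, so times earlier than that of the point
    at distance \<open>r\<close> belong to points closer than \<open>r\<close>.\<close>
  have bd: "\<bar>time_inv L \<sigma> u\<bar> < r" if "0 < r" "u < L (sgn \<sigma> * r)" for u r
  proof (rule ccontr)
    assume "\<not> ?thesis"
    then have "\<bar>sgn \<sigma> * r\<bar> \<le> \<bar>time_inv L \<sigma> u\<bar>" using \<open>\<sigma> \<noteq> 0\<close> that by (simp add: abs_mult)
    moreover have "0 < (sgn \<sigma> * r) * time_inv L \<sigma> u"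
      using time_inv_props(1)[OF \<open>\<sigma> \<noteq> 0\<close>, of u] that by (auto simp: zero_less_mult_iff sgn_if)
    ultimately have "L (sgn \<sigma> * r) \<le> L (time_inv L \<sigma> u)"
      using L_strict_mono[of "sgn \<sigma> * r" "time_inv L \<sigma> u"] L_inj
      by (smt (verit) zero_less_mult_iff)
    then show False using time_inv_props(2)[OF \<open>\<sigma> \<noteq> 0\<close>] that by simp
  qed
  define u0 where "u0 = L (sgn \<sigma> * \<delta>)"
  have step: "e (u + \<kappa>) = e u" if "u < u0" for u
  proof -
    let ?x = "time_inv L \<sigma> u"
    have x: "?x \<noteq> 0" "\<bar>?x\<bar> < \<delta>" "0 < \<sigma> * ?x" "L ?x = u"
      using time_inv_nonzero[OF \<open>\<sigma> \<noteq> 0\<close>] bd[OF \<delta>(1)] that time_inv_props[OF \<open>\<sigma> \<noteq> 0\<close>]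
      by (auto simp: u0_def)
    have "time_shift L \<kappa> ?x = time_inv L ?x (u + \<kappa>)"
      using x by (simp add: time_shift_def)
    also have "\<dots> = time_inv L \<sigma> (u + \<kappa>)" by (rule time_inv_cong[OF x(3), symmetric])
    finally show ?thesis using \<delta>(2)[OF x(1,2)] by (simp add: e_def)
  qed
  \<comment> \<open>Periods are always taken downwards, which keeps the argument below
    \<open>u0\<close>. A positive \<open>\<kappa>\<close> uses \<open>step\<close> at the lower
    point, a negative one at the upper point.\<close>
  have step': "e (u - \<bar>\<kappa>\<bar>) = e u" if "u < u0" for u
    using step[of u] step[of "u - \<bar>\<kappa>\<bar>"] that by (cases "0 < \<kappa>") auto
  have periodic: "e (u - real n * \<bar>\<kappa>\<bar>) = e u" if "u < u0" for u n
  proof (induction n)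
    case (Suc n)
    have "0 \<le> real n * \<bar>\<kappa>\<bar>" by simp
    then have "u - real n * \<bar>\<kappa>\<bar> < u0" using that by linarith
    from step'[OF this] Suc show ?case by (simp add: algebra_simps)
  qed simp
  have const: "e u = e v" if uv: "u < u0" "v < u0" for u v
  proof -
    \<comment> \<open>Moving \<open>u\<close> and \<open>v\<close> by the same number of periods towards \<open>0\<close> keeps the ratio of the points bounded.\<close>
    have "\<bar>e u - e v\<bar> \<le> \<epsilon>" if "0 < \<epsilon>" for \<epsilon>
    proof -
      obtain d where d: "0 < d" "\<And>x y. 0 < x * y \<Longrightarrow> \<bar>x\<bar> < d \<Longrightarrow> \<bar>y\<bar> < d \<Longrightarrow>
          \<bar>ln \<bar>x\<bar> - ln \<bar>y\<bar>\<bar> \<le> \<bar>u - v\<bar> / m \<Longrightarrow> \<bar>f x - f y\<bar> \<le> \<epsilon>"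
        using slowly_varyingD[OF sv \<open>0 < \<epsilon>\<close>, of "\<bar>u - v\<bar> / m"] by metis
      obtain n where n: "max u v - L (sgn \<sigma> * d) < real n * \<bar>\<kappa>\<bar>"
        using reals_Archimedean3[of "\<bar>\<kappa>\<bar>"] \<open>\<kappa> \<noteq> 0\<close> by auto
      define x where "x = time_inv L \<sigma> (u - real n * \<bar>\<kappa>\<bar>)"
      define y where "y = time_inv L \<sigma> (v - real n * \<bar>\<kappa>\<bar>)"
      have xy: "0 < x * y"
        using time_inv_props(1)[OF \<open>\<sigma> \<noteq> 0\<close>] same_sign_trans[of x \<sigma> y]
        by (simp add: x_def y_def mult.commute)
      have "\<bar>x\<bar> < d" "\<bar>y\<bar> < d" using n bd[OF d(1)] by (auto simp: x_def y_def)
      moreover have "m * \<bar>ln \<bar>x\<bar> - ln \<bar>y\<bar>\<bar> \<le> \<bar>u - v\<bar>"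
        using ln_dist_le[OF xy] time_inv_props(2)[OF \<open>\<sigma> \<noteq> 0\<close>] by (simp add: x_def y_def)
      then have "\<bar>ln \<bar>x\<bar> - ln \<bar>y\<bar>\<bar> \<le> \<bar>u - v\<bar> / m" using m_pos by (simp add: field_simps)
      ultimately have "\<bar>f x - f y\<bar> \<le> \<epsilon>" using d(2)[OF xy] by blast
      then show ?thesis
        using periodic[OF uv(1), of n] periodic[OF uv(2), of n] by (simp add: e_def x_def y_def)
    qed
    \<comment> \<open>A number bounded by half its own modulus vanishes.\<close>
    from this[of "\<bar>e u - e v\<bar> / 2"] show "e u = e v" by (cases "e u = e v") simp_all
  qed
  have "f x = e (u0 - 1)" if x: "0 < \<sigma> * x" "\<bar>x\<bar> < \<delta>" for x
  proof -
    have "L x < u0" unfolding u0_def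
      using x by (intro L_strict_mono) (auto simp: sgn_if zero_less_mult_iff abs_mult)
    moreover have "time_inv L \<sigma> (L x) = x" using x by (intro time_inv_eqI) auto
    ultimately show ?thesis using const[of "L x" "u0 - 1"] by (simp add: e_def)
  qed
  then show ?thesis using \<delta>(1) by blast
qed

end

section \<open>Rigidity of conjugacies differentiable at the fixed point\<close>

locale two_time_coordinates =
  a: time_coordinate p L m M + b: time_coordinate p' L' m' M' for p L m M p' L' m' M'
begin

text \<open>With \<open>W\<close> the slowly varying part of \<open>L'\<close>, one has
  \<open>L' (h x) - ln |x| = ln |h x / x| + W (h x)\<close>. The first term tends to
  \<open>ln |\<mu>|\<close>; in the second, slow variation allows \<open>h x\<close> to be replaced
  by \<open>sgn \<mu> * x\<close>, on the same side and at bounded ratio.\<close>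

lemma difference_of_conjugated_times_tendsto:
  assumes hd: "(h has_real_derivative \<mu>) (at 0)" and "h 0 = 0" and "\<mu> \<noteq> 0"
  shows "((\<lambda>x. (L' (h x) - L x) - ((L' (sgn \<mu> * x) - ln \<bar>sgn \<mu> * x\<bar>) - (L x - ln \<bar>x\<bar>)))
           \<longlongrightarrow> ln \<bar>\<mu>\<bar>) (at 0)"
proof -
  define W where "W x = L' x - ln \<bar>x\<bar>" for x
  have sv: "slowly_varying W" unfolding W_def by (rule b.slowly_varying_L)
  have q: "((\<lambda>x. h x / x) \<longlongrightarrow> \<mu>) (at 0)"
    using hd \<open>h 0 = 0\<close> by (simp add: has_field_derivative_iff)
  then have lnq: "((\<lambda>x. ln \<bar>h x / x\<bar>) \<longlongrightarrow> ln \<bar>\<mu>\<bar>) (at 0)"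
    using \<open>\<mu> \<noteq> 0\<close> by (intro tendsto_ln tendsto_rabs) auto
  \<comment> \<open>Eventually \<open>h x\<close> lies on the same side as \<open>\<mu> * x\<close>,
    which covers orientation-reversing \<open>h\<close> as well.\<close>
  have "((\<lambda>x. \<mu> * (h x / x)) \<longlongrightarrow> \<mu> * \<mu>) (at 0)" by (intro tendsto_intros q)
  then have sgn: "\<forall>\<^sub>F x in at 0. 0 < \<mu> * (h x / x)"
    using \<open>\<mu> \<noteq> 0\<close> by (intro order_tendstoD(1)) (auto simp: zero_less_mult_iff)
  have nz: "\<forall>\<^sub>F x in at (0::real). x \<noteq> 0" by (simp add: eventually_at_filter)
  have h0: "(h \<longlongrightarrow> 0) (at 0)" using DERIV_isCont[OF hd] \<open>h 0 = 0\<close> by (simp add: isCont_def)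
  have "((\<lambda>x. W (h x) - W (sgn \<mu> * x)) \<longlongrightarrow> 0) (at 0)"
  proof (rule tendstoI)
    fix e :: real assume "0 < e"
    then have e: "0 < e / 2" by simp
    \<comment> \<open>The window \<open>|ln |\<mu>|| + 1\<close> eventually contains
      \<open>ln |h x / x|\<close>, because this tends to \<open>ln |\<mu>|\<close>.\<close>
    obtain d where d: "0 < d" "\<And>x y. 0 < x * y \<Longrightarrow> \<bar>x\<bar> < d \<Longrightarrow> \<bar>y\<bar> < d \<Longrightarrow>
        \<bar>ln \<bar>x\<bar> - ln \<bar>y\<bar>\<bar> \<le> \<bar>ln \<bar>\<mu>\<bar>\<bar> + 1 \<Longrightarrow> \<bar>W x - W y\<bar> \<le> e / 2"
      using slowly_varyingD[OF sv e, of "\<bar>ln \<bar>\<mu>\<bar>\<bar> + 1"] by metis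
    have 1: "\<forall>\<^sub>F x in at 0. \<bar>h x\<bar> < d"
      using tendstoD[OF h0 d(1)] by simp
    have 2: "\<forall>\<^sub>F x::real in at 0. \<bar>x\<bar> < d"
      using d(1) by (auto simp: eventually_at)
    have 3: "\<forall>\<^sub>F x in at 0. dist (ln \<bar>h x / x\<bar>) (ln \<bar>\<mu>\<bar>) < 1"
      using tendstoD[OF lnq, of 1] by simp
    show "\<forall>\<^sub>F x in at 0. dist (W (h x) - W (sgn \<mu> * x)) 0 < e"
      using 1 2 3 nz sgn
    proof eventually_elim
      case (elim x)
      have "h x \<noteq> 0" using elim by auto
      have s: "0 < h x * (sgn \<mu> * x)"
        using elim(4,5) by (auto simp: sgn_if zero_less_mult_iff mult_less_0_iff zero_less_divide_iff
            divide_less_0_iff)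
      have "\<bar>ln \<bar>h x\<bar> - ln \<bar>sgn \<mu> * x\<bar>\<bar> = \<bar>ln \<bar>h x / x\<bar>\<bar>"
        using elim \<open>h x \<noteq> 0\<close> \<open>\<mu> \<noteq> 0\<close> by (simp add: abs_mult ln_div)
      also have "\<dots> \<le> \<bar>ln \<bar>\<mu>\<bar>\<bar> + 1" using elim(3) unfolding dist_real_def by linarith
      finally have "\<bar>W (h x) - W (sgn \<mu> * x)\<bar> \<le> e / 2"
        using elim \<open>\<mu> \<noteq> 0\<close> by (intro d(2)[OF s]) (auto simp: abs_mult)
      then show ?case using \<open>0 < e\<close> by simp
    qed
  qed
  from tendsto_add[OF lnq this]
  have "((\<lambda>x. ln \<bar>h x / x\<bar> + (W (h x) - W (sgn \<mu> * x))) \<longlongrightarrow> ln \<bar>\<mu>\<bar>) (at 0)" by simp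
  then show ?thesis
  proof (rule Lim_transform_eventually)
    show "\<forall>\<^sub>F x in at 0. ln \<bar>h x / x\<bar> + (W (h x) - W (sgn \<mu> * x)) =
        (L' (h x) - L x) - ((L' (sgn \<mu> * x) - ln \<bar>sgn \<mu> * x\<bar>) - (L x - ln \<bar>x\<bar>))"
      using nz sgn
    proof eventually_elim
      case (elim x)
      then have "h x \<noteq> 0" by auto
      then have "ln \<bar>h x / x\<bar> = ln \<bar>h x\<bar> - ln \<bar>x\<bar>" using elim by (simp add: ln_div)
      then show ?case by (simp add: W_def)
    qed
  qed
qed

text \<open>Under the conjugacy both times advance by \<open>\<kappa>\<close>, so \<open>D\<close>
  is invariant. It differs from the slowly varying \<open>Q\<close> by a convergent function, hence
  is slowly varying itself and constant on each side; \<open>Q\<close> then converges there.\<close>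

lemma germ_conjugacy_rigidity:
  assumes conj: "germ_conjugacy U V h k (time_shift L \<kappa>) (time_shift L' \<kappa>)"
    and hd: "(h has_real_derivative \<mu>) (at 0)" and "\<mu> \<noteq> 0" and "\<kappa> \<noteq> 0" and "\<sigma> \<noteq> 0"
  shows "\<exists>c. ((\<lambda>x. (L' (sgn \<mu> * x) - ln \<bar>sgn \<mu> * x\<bar>) - (L x - ln \<bar>x\<bar>)) \<longlongrightarrow> c)
           (at 0 within {x. 0 < \<sigma> * x})"
proof -
  define Q where "Q x = (L' (sgn \<mu> * x) - ln \<bar>sgn \<mu> * x\<bar>) - (L x - ln \<bar>x\<bar>)" for x
  define D where "D x = L' (h x) - L x" for x
  have U: "open U" "0 \<in> U" and hom: "homeomorphism U V h k" and h0: "h 0 = 0"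
    and ev: "\<forall>\<^sub>F y in nhds 0. h (time_shift L \<kappa> (k y)) = time_shift L' \<kappa> y"
    using conj by (auto simp: germ_conjugacy_def)
  have DQ: "((\<lambda>x. D x - Q x) \<longlongrightarrow> ln \<bar>\<mu>\<bar>) (at 0)"
    unfolding D_def Q_def by (rule difference_of_conjugated_times_tendsto[OF hd h0 \<open>\<mu> \<noteq> 0\<close>])
  have "slowly_varying Q" unfolding Q_def
    using \<open>\<mu> \<noteq> 0\<close> by (intro slowly_varying_diff slowly_varying_reflect[OF b.slowly_varying_L]
        a.slowly_varying_L) (simp add: abs_sgn_eq)
  moreover have "slowly_varying (\<lambda>x. Q x - D x)"
    using tendsto_minus[OF DQ] by (intro tendsto_imp_slowly_varying) simp
  ultimately have "slowly_varying (\<lambda>x. Q x - (Q x - D x))" by (rule slowly_varying_diff)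
  then have sv: "slowly_varying D" by simp
  \<comment> \<open>The conjugacy relation is given at points of the target; substituting
    \<open>h x\<close> moves it to the source.\<close>
  have "(h \<longlongrightarrow> 0) (at 0)" using DERIV_isCont[OF hd] h0 by (simp add: isCont_def)
  then have ev': "\<forall>\<^sub>F x in at 0. h (time_shift L \<kappa> (k (h x))) = time_shift L' \<kappa> (h x)"
    by (rule eventually_compose_filterlim[OF ev])
  have "\<forall>\<^sub>F x in at 0. x \<in> U" using U by (simp add: eventually_at_in_open')
  moreover have "\<forall>\<^sub>F x in at (0::real). x \<noteq> 0" by (simp add: eventually_at_filter)
  ultimately have inv: "\<forall>\<^sub>F x in at 0. D (time_shift L \<kappa> x) = D x"
    using ev'
  proof eventually_elim
    case (elim x)
    have k: "k (h x) = x" "k 0 = 0" using hom elim(1) U(2) h0 unfolding homeomorphism_def by metis+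
    then have "h x \<noteq> 0" using elim by auto
    then show ?case
      using elim k a.time_shift_props(2)[of x \<kappa>] b.time_shift_props(2)[of "h x" \<kappa>]
      by (simp add: D_def)
  qed
  obtain c \<delta> where "0 < \<delta>" "\<And>x. 0 < \<sigma> * x \<Longrightarrow> \<bar>x\<bar> < \<delta> \<Longrightarrow> D x = c"
    using a.eventually_constant_of_time_shift_invariant[OF sv \<open>\<kappa> \<noteq> 0\<close> \<open>\<sigma> \<noteq> 0\<close> inv] by blast
  then have Dc: "\<forall>\<^sub>F x in at 0 within {x. 0 < \<sigma> * x}. D x = c"
    by (auto simp: eventually_at intro!: exI[of _ \<delta>])
  have "((\<lambda>x. c - (D x - Q x)) \<longlongrightarrow> c - ln \<bar>\<mu>\<bar>) (at 0 within {x. 0 < \<sigma> * x})"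
    by (intro tendsto_intros tendsto_within_subset[OF DQ]) auto
  then have "(Q \<longlongrightarrow> c - ln \<bar>\<mu>\<bar>) (at 0 within {x. 0 < \<sigma> * x})"
    by (rule Lim_transform_eventually) (use Dc in eventually_elim, simp)
  then show ?thesis unfolding Q_def by blast
qed

section \<open>The bi-Lipschitz conjugacy obtained by matching times\<close>

definition transfer :: "real \<Rightarrow> real" where
  "transfer x = (if x = 0 then 0 else time_inv L' x (L x))"

lemma transfer_props:
  assumes "x \<noteq> 0"
  shows "0 < x * transfer x" "L' (transfer x) = L x"
  using b.time_inv_props[OF assms] assms by (auto simp: transfer_def)

lemma transfer_eqI:
  assumes "0 < x * y" "L' y = L x"
  shows "transfer x = y"
  using assms b.time_inv_eqI[of x y] by (auto simp: transfer_def)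

text \<open>The \<open>L'\<close>-times of a point and its image differ by at most \<open>B\<close>,
  which is a logarithmic distance of at most \<open>B / m'\<close>.\<close>

lemma transfer_bound:
  assumes B: "\<And>x. x \<noteq> 0 \<Longrightarrow> \<bar>L x - L' x\<bar> \<le> B"
  shows "\<bar>transfer x\<bar> \<le> exp (B / m') * \<bar>x\<bar>"
proof (cases "x = 0")
  case False
  let ?y = "transfer x"
  have y: "0 < x * ?y" "L' ?y = L x" using transfer_props[OF False] by auto
  have "m' * \<bar>ln \<bar>x\<bar> - ln \<bar>?y\<bar>\<bar> \<le> B"
    using b.ln_dist_le[OF y(1)] y(2) B[OF False] by (simp add: abs_minus_commute)
  then have "\<bar>ln \<bar>x\<bar> - ln \<bar>?y\<bar>\<bar> \<le> B / m'" using b.m_pos by (simp add: field_simps)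
  then have "ln \<bar>?y\<bar> \<le> ln \<bar>x\<bar> + B / m'" by (simp add: abs_le_iff)
  then have "exp (ln \<bar>?y\<bar>) \<le> exp (ln \<bar>x\<bar> + B / m')" by simp
  moreover have "?y \<noteq> 0" using y(1) by auto
  ultimately show ?thesis using False by (simp add: exp_add mult.commute)
qed (simp add: transfer_def)

lemma transfer_deriv:
  assumes "x \<noteq> 0"
  shows "(transfer has_real_derivative (transfer x / x) * (p x / p' (transfer x))) (at x)"
proof -
  have "((\<lambda>z. time_inv L' x (L z)) has_real_derivative
      time_inv L' x (L x) / p' (time_inv L' x (L x)) * (p x / x)) (at x)"
    using assms by (intro DERIV_chain2[OF b.time_inv_deriv] a.L_deriv)
  then have *: "((\<lambda>z. time_inv L' x (L z)) has_real_derivative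
      (transfer x / x) * (p x / p' (transfer x))) (at x)"
    using assms by (simp add: transfer_def mult.commute)
  \<comment> \<open>The selector in \<open>transfer z\<close> moves with \<open>z\<close>, but near
    \<open>x\<close> it keeps the sign of \<open>x\<close> and can be frozen there.\<close>
  show ?thesis
  proof (rule DERIV_cong_ev[THEN iffD1, OF refl _ refl *])
    have "open {z. 0 < x * z}" by (intro open_Collect_less continuous_intros)
    then have "\<forall>\<^sub>F z in nhds x. z \<in> {z. 0 < x * z}"
      using assms by (intro eventually_nhds_in_open) (auto simp: zero_less_mult_iff)
    then show "\<forall>\<^sub>F z in nhds x. time_inv L' x (L z) = transfer z"
      by eventually_elim (auto simp: transfer_def intro!: b.time_inv_cong)
  qed
qed

text \<open>On one side of 0 the derivative is bounded by \<open>exp (B / m') * (M / m')\<close>. As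
  \<open>transfer\<close> need not be differentiable at 0, points not on a common side are compared
  through 0, where \<open>|x| + |y| = |x - y|\<close>; the summand 1 covers that case.\<close>

lemma transfer_lipschitz:
  assumes B: "\<And>x. x \<noteq> 0 \<Longrightarrow> \<bar>L x - L' x\<bar> \<le> B"
  shows "(exp (B / m') * (1 + M / m'))-lipschitz_on UNIV transfer"
proof (rule lipschitz_onI)
  let ?C = "exp (B / m')"
  have M: "0 \<le> M / m'" using a.p_bounds[of 1] a.m_pos b.m_pos by simp
  then show C: "0 \<le> ?C * (1 + M / m')" by simp
  have deriv_bound: "\<bar>(transfer x / x) * (p x / p' (transfer x))\<bar> \<le> ?C * (M / m')" if "x \<noteq> 0" for x
  proof -
    have nz: "transfer x \<noteq> 0" using transfer_props(1)[OF that] by auto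
    have "\<bar>transfer x / x\<bar> \<le> ?C" using transfer_bound[OF B, of x] that by (simp add: field_simps)
    moreover have "\<bar>p x / p' (transfer x)\<bar> \<le> M / m'"
      unfolding abs_divide
      using a.p_bounds[OF that] b.p_bounds[OF nz] a.m_pos b.m_pos by (intro frac_le) auto
    ultimately show ?thesis unfolding abs_mult by (intro mult_mono) auto
  qed
  fix x y :: real
  show "dist (transfer x) (transfer y) \<le> ?C * (1 + M / m') * dist x y"
  proof (cases "0 < x * y")
    case True
    let ?S = "{z. 0 < x * z}"
    have "?S = (if 0 < x then {0<..} else {..<0})"
      using True by (auto simp: zero_less_mult_iff)
    then have "convex ?S" by auto
    then have "norm (transfer y - transfer x) \<le> ?C * (M / m') * norm (y - x)"
    proof (rule field_differentiable_bound)
      fix z assume "z \<in> ?S"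
      then have z: "z \<noteq> 0" by auto
      show "(transfer has_field_derivative (transfer z / z) * (p z / p' (transfer z))) (at z within ?S)"
        using transfer_deriv[OF z] by (rule DERIV_subset) simp
      show "norm ((transfer z / z) * (p z / p' (transfer z))) \<le> ?C * (M / m')"
        using deriv_bound[OF z] by simp
    qed (use True in \<open>auto simp: zero_less_mult_iff\<close>)
    also have "\<dots> \<le> ?C * (1 + M / m') * norm (y - x)" by (intro mult_right_mono mult_left_mono) auto
    finally show ?thesis by (simp only: dist_norm norm_minus_commute[of x y] norm_minus_commute[of "transfer x"])
  next
    case False
    have "\<bar>transfer x - transfer y\<bar> \<le> \<bar>transfer x\<bar> + \<bar>transfer y\<bar>" by simp
    also have "\<dots> \<le> ?C * \<bar>x\<bar> + ?C * \<bar>y\<bar>" by (intro add_mono transfer_bound B)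
    also have "\<dots> = ?C * \<bar>x - y\<bar>"
      using False by (auto simp: zero_less_mult_iff abs_if algebra_simps)
    also have "\<dots> \<le> ?C * (1 + M / m') * \<bar>x - y\<bar>"
      using M by (intro mult_right_mono) auto
    finally show ?thesis by (simp add: dist_real_def)
  qed
qed

end

text \<open>The two transfer maps are mutually inverse and the hypothesis on \<open>B\<close> is
  symmetric, so one Lipschitz estimate serves both directions.\<close>

lemma bilipschitz_conjugate_time_shifts:
  assumes "time_coordinate p L m M" "time_coordinate p' L' m' M'"
    and B: "\<And>x. x \<noteq> 0 \<Longrightarrow> \<bar>L x - L' x\<bar> \<le> B"
  shows "bilipschitz_conjugate (time_shift L \<kappa>) (time_shift L' \<kappa>)"
proof -
  interpret a: time_coordinate p L m M by fact
  interpret b: time_coordinate p' L' m' M' by fact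
  interpret ab: two_time_coordinates p L m M p' L' m' M' ..
  interpret ba: two_time_coordinates p' L' m' M' p L m M ..
  have lip: "(exp (B / m') * (1 + M / m'))-lipschitz_on UNIV ab.transfer"
    "(exp (B / m) * (1 + M' / m))-lipschitz_on UNIV ba.transfer"
    using B by (auto intro!: ab.transfer_lipschitz ba.transfer_lipschitz simp: abs_minus_commute)
  have inv: "ba.transfer (ab.transfer x) = x" for x
    using ab.transfer_props[of x]
    by (cases "x = 0") (auto simp: ab.transfer_def ba.transfer_def mult.commute intro!: a.time_inv_eqI)
  have inv': "ab.transfer (ba.transfer x) = x" for x
    using ba.transfer_props[of x]
    by (cases "x = 0") (auto simp: ab.transfer_def ba.transfer_def mult.commute intro!: b.time_inv_eqI)
  have "homeomorphism UNIV UNIV ab.transfer ba.transfer"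
    by (intro homeomorphismI lipschitz_on_continuous_on[OF lip(1)]
        lipschitz_on_continuous_on[OF lip(2)]) (auto simp: inv inv')
  moreover have "ab.transfer (time_shift L \<kappa> (ba.transfer y)) = time_shift L' \<kappa> y" for y
  proof (cases "y = 0")
    case False
    define x where "x = ba.transfer y"
    define z where "z = time_shift L' \<kappa> y"
    have x: "0 < y * x" "L x = L' y" using ba.transfer_props[OF False] by (auto simp: x_def)
    have z: "0 < y * z" "L' z = L' y + \<kappa>" using b.time_shift_props[OF False] by (auto simp: z_def)
    have s: "x \<noteq> 0" using x by auto
    have t: "0 < x * time_shift L \<kappa> x" "L (time_shift L \<kappa> x) = L x + \<kappa>"
      using a.time_shift_props[OF s] by auto
    have "ab.transfer (time_shift L \<kappa> x) = z"
      using x z t by (intro ab.transfer_eqI) (auto simp: zero_less_mult_iff)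
    then show ?thesis by (simp add: x_def z_def)
  qed (simp add: ab.transfer_def ba.transfer_def time_shift_def)
  ultimately have "germ_conjugacy UNIV UNIV ab.transfer ba.transfer
      (time_shift L \<kappa>) (time_shift L' \<kappa>)"
    by (simp add: germ_conjugacy_def ab.transfer_def)
  with lip show ?thesis unfolding bilipschitz_conjugate_def by blast
qed

text \<open>Differentiability of the inverse at 0 forces \<open>\<mu> \<noteq> 0\<close> by the
  chain rule. Only the sign of \<open>\<mu>\<close> survives, as \<open>\<tau>\<close>, with -1 for
  orientation-reversing conjugacies.\<close>

lemma C1_conjugate_time_shifts:
  assumes "time_coordinate p L m M" "time_coordinate p' L' m' M'" and "\<kappa> \<noteq> 0"
    and "C1_conjugate (time_shift L \<kappa>) (time_shift L' \<kappa>)"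
  obtains \<tau> :: real where "\<bar>\<tau>\<bar> = 1"
    "\<And>\<sigma>. \<sigma> \<noteq> 0 \<Longrightarrow> \<exists>c. ((\<lambda>x. (L' (\<tau> * x) - ln \<bar>\<tau> * x\<bar>) - (L x - ln \<bar>x\<bar>)) \<longlongrightarrow> c)
           (at 0 within {x. 0 < \<sigma> * x})"
proof -
  interpret a: time_coordinate p L m M by fact
  interpret b: time_coordinate p' L' m' M' by fact
  interpret ab: two_time_coordinates p L m M p' L' m' M' ..
  obtain U V h k where conj: "germ_conjugacy U V h k (time_shift L \<kappa>) (time_shift L' \<kappa>)"
    and C1: "h C1_differentiable_on U" "k C1_differentiable_on V"
    using assms(4) unfolding C1_conjugate_def by blast
  have U: "open U" "0 \<in> U" "0 \<in> V" and hom: "homeomorphism U V h k" and h0: "h 0 = 0"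
    using conj by (auto simp: germ_conjugacy_def)
  obtain \<mu> where hd: "(h has_real_derivative \<mu>) (at 0)"
    using C1(1) U by (auto simp: C1_differentiable_on_def has_real_derivative_iff_has_vector_derivative)
  obtain \<nu> where kd: "(k has_real_derivative \<nu>) (at 0)"
    using C1(2) U by (auto simp: C1_differentiable_on_def has_real_derivative_iff_has_vector_derivative)
  have "((\<lambda>x. k (h x)) has_real_derivative \<nu> * \<mu>) (at 0)"
    using kd h0 by (intro DERIV_chain2[OF _ hd]) simp
  moreover have "\<forall>\<^sub>F x in nhds 0. k (h x) = x"
    using eventually_nhds_in_open[OF U(1,2)]
    by eventually_elim (use hom in \<open>auto simp: homeomorphism_def\<close>)
  ultimately have "((\<lambda>x. x) has_real_derivative \<nu> * \<mu>) (at 0)"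
    using DERIV_cong_ev[OF refl _ refl, of "\<lambda>x. k (h x)" "\<lambda>x. x"] by blast
  then have "\<nu> * \<mu> = 1" using DERIV_ident DERIV_unique by blast
  then have "\<mu> \<noteq> 0" by auto
  then show ?thesis
    using that[of "sgn \<mu>"] ab.germ_conjugacy_rigidity[OF conj hd _ \<open>\<kappa> \<noteq> 0\<close>] by (simp add: abs_sgn_eq)
qed

subsection \<open>The oscillating perturbation\<close>

text \<open>The argument stands for \<open>ln |x|\<close>. As \<open>ln (1 + s^2)\<close> is
  unbounded but ever slower, the sine keeps oscillating while its derivatives decay. The factor
  \<open>1 / 4\<close> makes the derivative small enough for a perturbation of
  \<open>p \<ge> 1 / 2\<close> to stay positive.\<close>

definition osc :: "real \<Rightarrow> real" where
  "osc s = sin (ln (1 + s\<^sup>2)) / 4"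

definition osc' :: "real \<Rightarrow> real" where
  "osc' s = cos (ln (1 + s\<^sup>2)) * (s / (2 * (1 + s\<^sup>2)))"

definition osc'' :: "real \<Rightarrow> real" where
  "osc'' s = cos (ln (1 + s\<^sup>2)) * ((1 - s\<^sup>2) / (2 * (1 + s\<^sup>2)\<^sup>2))
     - sin (ln (1 + s\<^sup>2)) * (s\<^sup>2 / (1 + s\<^sup>2)\<^sup>2)"

lemma one_plus_square_pos: "0 < 1 + (s::real)\<^sup>2"
  by (simp add: add_pos_nonneg)

lemma osc_deriv: "(osc has_real_derivative osc' s) (at s)"
proof -
  have "1 + s\<^sup>2 \<noteq> 0" using one_plus_square_pos[of s] by simp
  then show ?thesis unfolding osc_def osc'_def
    using one_plus_square_pos[of s]
    by (auto intro!: derivative_eq_intros simp: field_simps)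
qed

lemma osc'_deriv: "(osc' has_real_derivative osc'' s) (at s)"
proof -
  have nz: "1 + s\<^sup>2 \<noteq> 0" using one_plus_square_pos[of s] by simp
  have 1: "((\<lambda>s. cos (ln (1 + s\<^sup>2))) has_real_derivative - sin (ln (1 + s\<^sup>2)) * (2 * s / (1 + s\<^sup>2))) (at s)"
    using one_plus_square_pos[of s] by (auto intro!: derivative_eq_intros)
  have 2: "((\<lambda>s. s / (2 * (1 + s\<^sup>2))) has_real_derivative
      (1 * (2 * (1 + s\<^sup>2)) - s * (4 * s)) / ((2 * (1 + s\<^sup>2)) * (2 * (1 + s\<^sup>2)))) (at s)"
    using nz by (intro DERIV_divide) (auto intro!: derivative_eq_intros)
  have e1: "(1 * (2 * (1 + s\<^sup>2)) - s * (4 * s)) / ((2 * (1 + s\<^sup>2)) * (2 * (1 + s\<^sup>2)))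
      = (1 - s\<^sup>2) / (2 * (1 + s\<^sup>2)\<^sup>2)"
    using nz by (simp add: divide_simps power2_eq_square) (simp add: algebra_simps)
  have e2: "(2 * s / (1 + s\<^sup>2)) * (s / (2 * (1 + s\<^sup>2))) = s\<^sup>2 / (1 + s\<^sup>2)\<^sup>2"
    using nz by (simp add: divide_simps power2_eq_square)
  have "((\<lambda>s. cos (ln (1 + s\<^sup>2)) * (s / (2 * (1 + s\<^sup>2)))) has_real_derivative
      - sin (ln (1 + s\<^sup>2)) * (2 * s / (1 + s\<^sup>2)) * (s / (2 * (1 + s\<^sup>2)))
      + (1 - s\<^sup>2) / (2 * (1 + s\<^sup>2)\<^sup>2) * cos (ln (1 + s\<^sup>2))) (at s)"
    using DERIV_mult[OF 1 2] unfolding e1 .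
  then show ?thesis unfolding osc'_def[abs_def] osc''_def mult.assoc e2 by (simp add: mult.commute)
qed

lemma abs_osc_le: "\<bar>osc s\<bar> \<le> 1 / 4"
  unfolding osc_def by simp

lemma abs_osc'_le: "\<bar>osc' s\<bar> \<le> 1 / 4"
proof -
  have "0 \<le> (\<bar>s\<bar> - 1)\<^sup>2" by simp
  then have "2 * \<bar>s\<bar> \<le> 1 + s\<^sup>2" by (simp add: power2_diff)
  then have "\<bar>s / (2 * (1 + s\<^sup>2))\<bar> \<le> 1 / 4"
    using one_plus_square_pos[of s] by (simp add: abs_mult field_simps)
  then have "\<bar>cos (ln (1 + s\<^sup>2))\<bar> * \<bar>s / (2 * (1 + s\<^sup>2))\<bar> \<le> 1 * (1 / 4)"
    by (intro mult_mono) auto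
  then show ?thesis by (simp add: osc'_def abs_mult)
qed

lemma osc'_tendsto: "(osc' \<longlongrightarrow> 0) at_bot"
  unfolding osc'_def
proof (rule Lim_null_comparison)
  show "((\<lambda>s::real. \<bar>s / (2 * (1 + s\<^sup>2))\<bar>) \<longlongrightarrow> 0) at_bot" by real_asymp
  show "\<forall>\<^sub>F s in at_bot. norm (cos (ln (1 + s\<^sup>2)) * (s / (2 * (1 + s\<^sup>2)))) \<le> \<bar>s / (2 * (1 + s\<^sup>2))\<bar>"
    by (intro always_eventually allI) (simp only: real_norm_def abs_mult mult_left_le_one_le abs_cos_le_one abs_ge_zero)
qed

lemma osc''_tendsto: "(osc'' \<longlongrightarrow> 0) at_bot"
proof (rule Lim_null_comparison)
  show "((\<lambda>s::real. \<bar>(1 - s\<^sup>2) / (2 * (1 + s\<^sup>2)\<^sup>2)\<bar> + \<bar>s\<^sup>2 / (1 + s\<^sup>2)\<^sup>2\<bar>) \<longlongrightarrow> 0) at_bot"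
    by real_asymp
  show "\<forall>\<^sub>F s in at_bot. norm (osc'' s) \<le>
      \<bar>(1 - s\<^sup>2) / (2 * (1 + s\<^sup>2)\<^sup>2)\<bar> + \<bar>s\<^sup>2 / (1 + s\<^sup>2)\<^sup>2\<bar>"
    unfolding osc''_def real_norm_def
    by (intro always_eventually allI order_trans[OF abs_triangle_ineq4] add_mono)
      (simp_all only: abs_mult mult_left_le_one_le abs_cos_le_one abs_sin_le_one abs_ge_zero)
qed

lemma osc_divergent: "\<not> (osc \<longlongrightarrow> l) at_bot"
proof
  assume lim: "(osc \<longlongrightarrow> l) at_bot"
  \<comment> \<open>At these points \<open>ln (1 + s^2)\<close> equals
    \<open>pi / 2 + n * pi\<close>, so the sine alternates between 1 and -1.\<close>
  define s where "s n = - sqrt (exp (pi / 2 + real n * pi) - 1)" for n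
  have "filterlim s at_bot sequentially" unfolding s_def by real_asymp
  with lim have X: "(\<lambda>n. osc (s n)) \<longlonglongrightarrow> l" by (rule filterlim_compose)
  have val: "osc (s n) = (- 1) ^ n / 4" for n
  proof -
    have "1 \<le> exp (pi / 2 + real n * pi)" by simp
    then have "osc (s n) = sin (pi / 2 + real n * pi) / 4" by (simp add: osc_def s_def)
    then show ?thesis by (simp add: sin_add cos_npi)
  qed
  have "(\<lambda>n. osc (s (Suc n))) \<longlonglongrightarrow> l" using X by (rule LIMSEQ_Suc)
  moreover have "(\<lambda>n. - osc (s n)) \<longlonglongrightarrow> - l" using X by (rule tendsto_minus)
  ultimately have "l = - l" unfolding val by (intro LIMSEQ_unique) auto
  moreover have "\<bar>l\<bar> = 1 / 4"
    using tendsto_rabs[OF X] unfolding val by (simp add: LIMSEQ_const_iff power_abs)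
  ultimately show False by simp
qed

section \<open>The perturbation in the original coordinate\<close>

lemma ln_abs_deriv:
  assumes "x \<noteq> 0"
  shows "((\<lambda>x::real. ln \<bar>x\<bar>) has_real_derivative 1 / x) (at x)"
proof -
  have "open {z. 0 < x * z}" by (intro open_Collect_less continuous_intros)
  then have "\<forall>\<^sub>F z in nhds x. z \<in> {z. 0 < x * z}"
    using assms by (intro eventually_nhds_in_open) (auto simp: zero_less_mult_iff)
  then have ev: "\<forall>\<^sub>F z in nhds x. ln (sgn x * z) = ln \<bar>z\<bar>"
    by eventually_elim (auto simp: zero_less_mult_iff)
  have "((\<lambda>z. ln (sgn x * z)) has_real_derivative 1 / x) (at x)"
    using assms by (auto intro!: derivative_eq_intros simp: sgn_if)
  then show ?thesis by (rule DERIV_cong_ev[OF refl ev refl, THEN iffD1])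
qed

lemma filterlim_ln_abs: "filterlim (\<lambda>x::real. ln \<bar>x\<bar>) at_bot (at 0)"
proof (rule filterlim_compose[OF ln_at_0])
  show "filterlim (\<lambda>x::real. \<bar>x\<bar>) (at_right 0) (at 0)"
    by (auto simp: filterlim_at eventually_at_filter intro!: tendsto_rabs_zero)
qed

text \<open>With \<open>w x = osc (ln |x|)\<close> this is \<open>x w'(x)\<close>, the correction to
  \<open>p\<close>; the value 0 at the origin is its limit.\<close>

definition log_osc' :: "real \<Rightarrow> real" where
  "log_osc' x = (if x = 0 then 0 else osc' (ln \<bar>x\<bar>))"

text \<open>This is \<open>x^2 w''(x)\<close>, the term that the perturbation adds to the numerator
  of the derivative of the field.\<close>

definition log_osc'' :: "real \<Rightarrow> real" where
  "log_osc'' x = (if x = 0 then 0 else osc'' (ln \<bar>x\<bar>) - osc' (ln \<bar>x\<bar>))"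

lemma log_osc'_deriv:
  assumes "x \<noteq> 0"
  shows "(log_osc' has_real_derivative osc'' (ln \<bar>x\<bar>) / x) (at x)"
proof -
  have "((\<lambda>x. osc' (ln \<bar>x\<bar>)) has_real_derivative osc'' (ln \<bar>x\<bar>) * (1 / x)) (at x)"
    by (intro DERIV_chain2[OF osc'_deriv] ln_abs_deriv assms)
  moreover have "\<forall>\<^sub>F z in nhds x. osc' (ln \<bar>z\<bar>) = log_osc' z"
    using t1_space_nhds[OF assms] by eventually_elim (simp add: log_osc'_def)
  ultimately show ?thesis using DERIV_cong_ev[OF refl _ refl] by fastforce
qed

lemma isCont_if_zero:
  fixes f :: "real \<Rightarrow> real"
  assumes "(f \<longlongrightarrow> c) (at 0)" and "x \<noteq> 0 \<Longrightarrow> isCont f x"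
  shows "isCont (\<lambda>x. if x = 0 then c else f x) x"
proof (cases "x = 0")
  case True
  have "((\<lambda>x. if x = 0 then c else f x) \<longlongrightarrow> c) (at 0)"
    using assms(1) by (rule Lim_transform_eventually) (simp add: eventually_at_filter)
  then show ?thesis using True by (simp add: isCont_def)
next
  case False
  have "\<forall>\<^sub>F z in nhds x. (if z = 0 then c else f z) = f z"
    using t1_space_nhds[OF False] by eventually_elim simp
  then show ?thesis using assms(2)[OF False] isCont_cong[of "\<lambda>x. if x = 0 then c else f x" f] by blast
qed

lemma isCont_log_osc': "isCont log_osc' x"
proof -
  have "((\<lambda>x. osc' (ln \<bar>x\<bar>)) \<longlongrightarrow> 0) (at 0)"
    by (rule filterlim_compose[OF osc'_tendsto filterlim_ln_abs])
  then show ?thesis unfolding log_osc'_def[abs_def]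
    by (rule isCont_if_zero) (intro isCont_o2[OF DERIV_isCont[OF ln_abs_deriv] DERIV_isCont[OF osc'_deriv]])
qed

lemma isCont_log_osc'': "isCont log_osc'' x"
proof -
  have cont: "isCont osc'' s" for s
    unfolding osc''_def using one_plus_square_pos[of s] by (auto intro!: continuous_intros)
  have "((\<lambda>x. osc'' (ln \<bar>x\<bar>) - osc' (ln \<bar>x\<bar>)) \<longlongrightarrow> 0 - 0) (at 0)"
    by (intro tendsto_diff filterlim_compose[OF osc'_tendsto filterlim_ln_abs]
        filterlim_compose[OF osc''_tendsto filterlim_ln_abs])
  then have "((\<lambda>x. osc'' (ln \<bar>x\<bar>) - osc' (ln \<bar>x\<bar>)) \<longlongrightarrow> 0) (at 0)" by simp
  then show ?thesis unfolding log_osc''_def[abs_def]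
    by (rule isCont_if_zero) (intro isCont_diff isCont_o2[OF DERIV_isCont[OF ln_abs_deriv] cont]
        isCont_o2[OF DERIV_isCont[OF ln_abs_deriv] DERIV_isCont[OF osc'_deriv]])
qed

lemma abs_log_osc'_le: "\<bar>log_osc' x\<bar> \<le> 1 / 4"
  using abs_osc'_le by (simp add: log_osc'_def)

text \<open>\<open>p\<close> need not be differentiable at 0, so its derivative is eliminated:
  \<open>p = \<kappa> x / X\<close> gives \<open>x p' = p - p^2 X' / \<kappa>\<close> away from 0.
  The resulting formula remains meaningful at 0.\<close>

lemma perturbed_field_deriv:
  assumes dX: "\<And>x. \<bar>x\<bar> < \<delta> \<Longrightarrow> (X has_real_derivative X' x) (at x)"
    and X: "\<And>x. \<bar>x\<bar> < \<delta> \<Longrightarrow> X x = \<kappa> * x / p x" and "\<kappa> \<noteq> 0"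
    and p: "\<And>x. isCont p x" "p 0 = 1" "\<And>x. 1 / 2 \<le> p x" and "\<bar>\<alpha>\<bar> \<le> 1" and x: "\<bar>x\<bar> < \<delta>"
  shows "((\<lambda>x. \<kappa> * x / (p x + \<alpha> * log_osc' x)) has_real_derivative
          ((p x)\<^sup>2 * X' x - \<alpha> * \<kappa> * log_osc'' x) / (p x + \<alpha> * log_osc' x)\<^sup>2) (at x)"
proof -
  have pos: "0 < p z + \<alpha> * log_osc' z" for z
  proof -
    have "\<bar>\<alpha> * log_osc' z\<bar> \<le> 1 * (1 / 4)"
      unfolding abs_mult using \<open>\<bar>\<alpha>\<bar> \<le> 1\<close> abs_log_osc'_le by (intro mult_mono) auto
    then show ?thesis using p(3)[of z] by simp
  qed
  have "\<forall>\<^sub>F z in nhds x. z \<in> {-\<delta><..<\<delta>}"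
    using x by (intro eventually_nhds_in_open) auto
  then have near: "\<forall>\<^sub>F z in nhds x. \<bar>z\<bar> < \<delta>" by eventually_elim auto
  show ?thesis
  proof (cases "x = 0")
    case True
    have quot: "((\<lambda>z. \<kappa> / (p z + \<alpha> * log_osc' z)) \<longlongrightarrow> \<kappa> / (1 + \<alpha> * 0)) (at 0)"
    proof (intro tendsto_intros)
      show "(p \<longlongrightarrow> 1) (at 0)" using p(1)[of 0] p(2) by (simp add: isCont_def)
      show "(log_osc' \<longlongrightarrow> 0) (at 0)"
        using isCont_log_osc'[of 0] unfolding isCont_def by (simp add: log_osc'_def[of 0])
    qed simp
    have 1: "((\<lambda>x. \<kappa> * x / (p x + \<alpha> * log_osc' x)) has_real_derivative \<kappa>) (at 0)"
      unfolding has_field_derivative_iff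
      by (rule Lim_transform_eventually[of "\<lambda>z. \<kappa> / (p z + \<alpha> * log_osc' z)"])
        (use quot in \<open>auto simp: eventually_at_filter\<close>)
    \<comment> \<open>The same difference quotient without perturbation identifies
      \<open>X' 0\<close> as \<open>\<kappa>\<close>, which is the value of the claimed formula at
      0.\<close>
    have quot: "((\<lambda>z. \<kappa> / p z) \<longlongrightarrow> \<kappa> / 1) (at 0)"
      using p(1)[of 0] p(2) by (intro tendsto_intros) (auto simp: isCont_def)
    have "((\<lambda>x. \<kappa> * x / p x) has_real_derivative \<kappa>) (at 0)"
      unfolding has_field_derivative_iff
      by (rule Lim_transform_eventually[of "\<lambda>z. \<kappa> / p z"])
        (use quot in \<open>auto simp: eventually_at_filter\<close>)
    moreover have ev: "\<forall>\<^sub>F z in nhds 0. \<kappa> * z / p z = X z"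
      using near unfolding True by eventually_elim (simp add: X)
    ultimately have "(X has_real_derivative \<kappa>) (at 0)"
      by (intro DERIV_cong_ev[OF refl ev refl, THEN iffD1])
    then have "X' 0 = \<kappa>" using dX[of 0] x True DERIV_unique by auto
    with 1 show ?thesis using True p(2) by (simp add: log_osc'_def log_osc''_def)
  next
    case False
    have pnz: "p z \<noteq> 0" for z using p(3)[of z] by auto
    have nz: "X x \<noteq> 0" using X[OF x] pnz \<open>\<kappa> \<noteq> 0\<close> False by simp
    have "((\<lambda>z. \<kappa> * z / X z) has_real_derivative (\<kappa> * X x - \<kappa> * x * X' x) / (X x * X x)) (at x)"
      using nz by (intro DERIV_divide dX x) (auto intro!: derivative_eq_intros)
    \<comment> \<open>Away from 0, differentiability of \<open>p\<close> is recovered from that of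
      \<open>X\<close> by solving for \<open>p\<close>.\<close>
    moreover have ev: "\<forall>\<^sub>F z in nhds x. \<kappa> * z / X z = p z"
      using near t1_space_nhds[OF False] by eventually_elim (simp add: X pnz \<open>\<kappa> \<noteq> 0\<close>)
    ultimately have dp: "(p has_real_derivative (\<kappa> * X x - \<kappa> * x * X' x) / (X x * X x)) (at x)"
      by (intro DERIV_cong_ev[OF refl ev refl, THEN iffD1])
    have dp': "(\<kappa> * X x - \<kappa> * x * X' x) / (X x * X x) = (p x - (p x)\<^sup>2 * X' x / \<kappa>) / x"
      unfolding X[OF x] using False \<open>\<kappa> \<noteq> 0\<close> pnz[of x] by (simp add: field_simps power2_eq_square)
    let ?P = "p x + \<alpha> * log_osc' x"
    have "((\<lambda>x. \<kappa> * x / (p x + \<alpha> * log_osc' x)) has_real_derivative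
        (\<kappa> * ?P - \<kappa> * x * ((p x - (p x)\<^sup>2 * X' x / \<kappa>) / x + \<alpha> * (osc'' (ln \<bar>x\<bar>) / x)))
          / (?P * ?P)) (at x)"
      using pos[of x] dp[unfolded dp'] log_osc'_deriv[OF False]
      by (intro DERIV_divide) (auto intro!: derivative_eq_intros)
    moreover have "\<kappa> * ?P - \<kappa> * x * ((p x - (p x)\<^sup>2 * X' x / \<kappa>) / x + \<alpha> * (osc'' (ln \<bar>x\<bar>) / x))
        = (p x)\<^sup>2 * X' x - \<alpha> * \<kappa> * log_osc'' x"
      using False \<open>\<kappa> \<noteq> 0\<close> by (simp add: log_osc'_def log_osc''_def field_simps)
    ultimately show ?thesis by (simp add: power2_eq_square)
  qed
qed

text \<open>By compactness of \<open>S\<close>, as in the tube lemma, one neighbourhood of the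
  parameter serves all points of \<open>S\<close>.\<close>

lemma uniform_limit_of_jointly_continuous:
  fixes f :: "'a::topological_space \<Rightarrow> 'b::topological_space \<Rightarrow> 'c::metric_space"
  assumes "continuous_on (I \<times> S) (\<lambda>z. f (fst z) (snd z))" "compact S" "a \<in> I"
  shows "uniform_limit S f (f a) (at a within I)"
proof (rule uniform_limitI)
  fix e :: real assume "0 < e"
  then have "0 < e / 2" by simp
  from continuous_on_prod_compactE[OF assms this] obtain T where
    T: "a \<in> T" "open T" "\<forall>b\<in>T \<inter> I. \<forall>t\<in>S. dist (f b t) (f a t) \<le> e / 2" by auto
  have "\<forall>\<^sub>F b in at a within I. b \<in> T \<inter> I"
    using T by (auto simp: eventually_at_topological)
  then show "\<forall>\<^sub>F b in at a within I. \<forall>x\<in>S. dist (f b x) (f a x) < e"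
  proof eventually_elim
    case (elim b)
    have "dist (f b x) (f a x) \<le> e / 2" if "x \<in> S" for x using T(3) elim that by blast
    then show ?case using \<open>0 < e\<close> by fastforce
  qed
qed

subsection \<open>The path of vector fields\<close>

text \<open>The pole separates the half-lines, so antiderivatives are chosen on each independently
  and glued.\<close>

lemma exists_time_coordinate:
  fixes p :: "real \<Rightarrow> real"
  assumes "\<And>x. isCont p x"
  shows "\<exists>L. \<forall>x. x \<noteq> 0 \<longrightarrow> (L has_real_derivative p x / x) (at x)"
proof -
  have cont: "isCont (\<lambda>x. p x / x) x" if "x \<noteq> 0" for x
    using assms that by (intro continuous_intros) auto
  obtain G where G: "\<And>x::real. 0 < ereal x \<Longrightarrow> ereal x < \<infinity> \<Longrightarrow> (G has_vector_derivative p x / x) (at x)"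
    using einterval_antiderivative[of 0 \<infinity> "\<lambda>x. p x / x"] cont by auto
  obtain H where H: "\<And>x::real. -\<infinity> < ereal x \<Longrightarrow> ereal x < 0 \<Longrightarrow> (H has_vector_derivative p x / x) (at x)"
    using einterval_antiderivative[of "-\<infinity>" 0 "\<lambda>x. p x / x"] cont by auto
  define L where "L x = (if 0 < x then G x else H x)" for x
  have "(L has_real_derivative p x / x) (at x)" if "x \<noteq> 0" for x
  proof (cases "0 < x")
    case True
    then have "\<forall>\<^sub>F z in nhds x. z \<in> {0<..}" by (intro eventually_nhds_in_open) auto
    then have ev: "\<forall>\<^sub>F z in nhds x. G z = L z" by eventually_elim (simp add: L_def)
    have "(G has_real_derivative p x / x) (at x)"
      using G[of x] True by (simp add: has_real_derivative_iff_has_vector_derivative)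
    then show ?thesis by (rule DERIV_cong_ev[OF refl ev refl, THEN iffD1])
  next
    case False
    then have "\<forall>\<^sub>F z in nhds x. z \<in> {..<0}" using that by (intro eventually_nhds_in_open) auto
    then have ev: "\<forall>\<^sub>F z in nhds x. H z = L z" by eventually_elim (simp add: L_def)
    have "(H has_real_derivative p x / x) (at x)"
      using H[of x] False that by (simp add: has_real_derivative_iff_has_vector_derivative)
    then show ?thesis by (rule DERIV_cong_ev[OF refl ev refl, THEN iffD1])
  qed
  then show ?thesis by blast
qed

text \<open>Adding \<open>\<alpha> w\<close> to \<open>L\<close> adds
  \<open>\<alpha> x w'(x)\<close> to \<open>p\<close>, of modulus at most \<open>1 / 4\<close>; the
  bounds \<open>1 / 2\<close> and \<open>2\<close> therefore widen to \<open>1 / 4\<close> and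
  \<open>9 / 4\<close>.\<close>

lemma time_coordinate_perturbation:
  assumes "\<And>x. isCont p x" "p 0 = 1" "\<And>x. 1 / 2 \<le> p x" "\<And>x. p x \<le> 2" and "\<bar>\<alpha>\<bar> \<le> 1"
    and L: "\<And>x. x \<noteq> 0 \<Longrightarrow> (L has_real_derivative p x / x) (at x)"
  shows "time_coordinate (\<lambda>x. p x + \<alpha> * log_osc' x) (\<lambda>x. L x + \<alpha> * osc (ln \<bar>x\<bar>)) (1 / 4) (9 / 4)"
proof
  fix x :: real
  have "\<bar>\<alpha> * log_osc' x\<bar> \<le> 1 * (1 / 4)"
    unfolding abs_mult using assms(5) abs_log_osc'_le by (intro mult_mono) auto
  then show "1 / 4 \<le> p x + \<alpha> * log_osc' x \<and> p x + \<alpha> * log_osc' x \<le> 9 / 4"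
    using assms(3)[of x] assms(4)[of x] by (auto simp: abs_le_iff)
next
  have "isCont (\<lambda>x. p x + \<alpha> * log_osc' x) 0"
    by (intro continuous_intros assms(1) isCont_log_osc')
  then show "((\<lambda>x. p x + \<alpha> * log_osc' x) \<longlongrightarrow> 1) (at 0)"
    by (simp add: isCont_def assms(2) log_osc'_def[of 0])
next
  fix x :: real assume x: "x \<noteq> 0"
  have "((\<lambda>x. osc (ln \<bar>x\<bar>)) has_real_derivative osc' (ln \<bar>x\<bar>) * (1 / x)) (at x)"
    by (intro DERIV_chain2[OF osc_deriv] ln_abs_deriv x)
  then have "((\<lambda>x. L x + \<alpha> * osc (ln \<bar>x\<bar>)) has_real_derivative
      p x / x + \<alpha> * (osc' (ln \<bar>x\<bar>) * (1 / x))) (at x)"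
    by (intro DERIV_add L x DERIV_cmult)
  then show "((\<lambda>x. L x + \<alpha> * osc (ln \<bar>x\<bar>)) has_real_derivative
      (p x + \<alpha> * log_osc' x) / x) (at x)"
    using x by (simp add: log_osc'_def add_divide_distrib)
qed simp

text \<open>Since \<open>\<tau>\<close> is 1 or -1, the points \<open>\<tau> * x\<close> and
  \<open>- \<tau> * x\<close> are \<open>x\<close> and \<open>-x\<close> in some order. The sum of
  \<open>Q\<close> over both sides thus loses \<open>L\<close> and the logarithms and keeps a
  nonzero multiple of \<open>osc\<close>.\<close>

lemma not_C1_conjugate_perturbations:
  assumes tc: "time_coordinate p (\<lambda>x. L x + \<alpha> * osc (ln \<bar>x\<bar>)) m M"
      "time_coordinate p' (\<lambda>x. L x + \<beta> * osc (ln \<bar>x\<bar>)) m' M'"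
    and "\<kappa> \<noteq> 0" "\<alpha> \<noteq> \<beta>"
  shows "\<not> C1_conjugate (time_shift (\<lambda>x. L x + \<alpha> * osc (ln \<bar>x\<bar>)) \<kappa>)
                       (time_shift (\<lambda>x. L x + \<beta> * osc (ln \<bar>x\<bar>)) \<kappa>)"
proof
  assume "C1_conjugate (time_shift (\<lambda>x. L x + \<alpha> * osc (ln \<bar>x\<bar>)) \<kappa>)
                       (time_shift (\<lambda>x. L x + \<beta> * osc (ln \<bar>x\<bar>)) \<kappa>)"
  then show False
  proof (rule C1_conjugate_time_shifts[OF tc \<open>\<kappa> \<noteq> 0\<close>])
    fix \<tau> :: real
    assume \<tau>: "\<bar>\<tau>\<bar> = 1" and lim: "\<And>\<sigma>. \<sigma> \<noteq> 0 \<Longrightarrow> \<exists>c. ((\<lambda>x. (L (\<tau> * x) + \<beta> * osc (ln \<bar>\<tau> * x\<bar>) - ln \<bar>\<tau> * x\<bar>)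
          - (L x + \<alpha> * osc (ln \<bar>x\<bar>) - ln \<bar>x\<bar>)) \<longlongrightarrow> c) (at 0 within {x. 0 < \<sigma> * x})"
    define Q where "Q x = (L (\<tau> * x) + \<beta> * osc (ln \<bar>\<tau> * x\<bar>) - ln \<bar>\<tau> * x\<bar>)
        - (L x + \<alpha> * osc (ln \<bar>x\<bar>) - ln \<bar>x\<bar>)" for x
    obtain c d where c: "(Q \<longlongrightarrow> c) (at 0 within {x. 0 < 1 * x})"
      and d: "(Q \<longlongrightarrow> d) (at 0 within {x. 0 < - 1 * x})"
      using lim[of 1] lim[of "- 1"] unfolding Q_def by auto
    have "filterlim (\<lambda>s. exp s) (at 0 within {x::real. 0 < 1 * x}) at_bot"
      by (simp add: filterlim_at exp_at_bot)
    then have 1: "((\<lambda>s. Q (exp s)) \<longlongrightarrow> c) at_bot" by (rule filterlim_compose[OF c])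
    have "filterlim (\<lambda>s. - exp s) (at 0 within {x::real. 0 < - 1 * x}) at_bot"
      using tendsto_minus[OF exp_at_bot] by (simp add: filterlim_at)
    then have 2: "((\<lambda>s. Q (- exp s)) \<longlongrightarrow> d) at_bot" by (rule filterlim_compose[OF d])
    have "Q (exp s) + Q (- exp s) = 2 * (\<beta> - \<alpha>) * osc s" for s
    proof -
      consider "\<tau> = 1" | "\<tau> = - 1" using \<tau> by linarith
      then show ?thesis by cases (simp_all add: Q_def algebra_simps)
    qed
    then have "((\<lambda>s. 2 * (\<beta> - \<alpha>) * osc s) \<longlongrightarrow> c + d) at_bot" using tendsto_add[OF 1 2] by simp
    from tendsto_divide[OF this tendsto_const[of "2 * (\<beta> - \<alpha>)"]]
    have "(osc \<longlongrightarrow> (c + d) / (2 * (\<beta> - \<alpha>))) at_bot" using \<open>\<alpha> \<noteq> \<beta>\<close> by simp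
    then show False using osc_divergent by blast
  qed
qed

text \<open>Near 0 the quotient \<open>\<kappa> x / X x\<close> tends to 1, so it is between
  \<open>1 / 2\<close> and 2 on a small interval. Freezing it outside that interval makes continuity
  and bounds global without changing the germ.\<close>

lemma hyperbolic_germ_normal_form:
  assumes "hyperbolic_germ X"
  obtains X' p \<delta> where "0 < \<delta>" "continuous_on {-\<delta><..<\<delta>} X'"
    "\<And>x. \<bar>x\<bar> < \<delta> \<Longrightarrow> (X has_real_derivative X' x) (at x)"
    "\<And>x. \<bar>x\<bar> < \<delta> \<Longrightarrow> X x = multiplier X * x / p x"
    "\<And>x. isCont p x" "p 0 = 1" "\<And>x. 1 / 2 \<le> p x" "\<And>x. p x \<le> 2"
proof -
  define \<kappa> where "\<kappa> = multiplier X"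
  have "\<kappa> \<noteq> 0" "X 0 = 0" using assms by (auto simp: hyperbolic_germ_def C1_vector_field_germ_def \<kappa>_def)
  obtain \<epsilon> X' where "0 < \<epsilon>" and X'_cont: "continuous_on {-\<epsilon><..<\<epsilon>} X'"
    and X': "\<forall>x\<in>{-\<epsilon><..<\<epsilon>}. (X has_vector_derivative X' x) (at x)"
    using assms unfolding hyperbolic_germ_def C1_vector_field_germ_def C1_differentiable_on_def
    by blast
  have dX: "(X has_real_derivative X' x) (at x)" if "\<bar>x\<bar> < \<epsilon>" for x
    using X' that by (auto simp: has_real_derivative_iff_has_vector_derivative abs_less_iff)
  have "(X has_real_derivative \<kappa>) (at 0)"
    using dX[of 0] \<open>0 < \<epsilon>\<close> DERIV_imp_deriv unfolding \<kappa>_def multiplier_def by fastforce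
  then have "((\<lambda>x. X x / x) \<longlongrightarrow> \<kappa>) (at 0)"
    using \<open>X 0 = 0\<close> by (simp add: has_field_derivative_iff)
  from tendsto_divide[OF this tendsto_const \<open>\<kappa> \<noteq> 0\<close>]
  have lim: "((\<lambda>x. X x / (\<kappa> * x)) \<longlongrightarrow> 1) (at 0)" using \<open>\<kappa> \<noteq> 0\<close> by (simp add: mult.commute)
  obtain \<epsilon>' where "0 < \<epsilon>'" and close: "\<And>x. x \<noteq> 0 \<Longrightarrow> \<bar>x\<bar> < \<epsilon>' \<Longrightarrow> \<bar>X x / (\<kappa> * x) - 1\<bar> < 1 / 2"
    using LIM_D[OF lim, of "1 / 2"] by auto
  \<comment> \<open>Halving leaves the closed interval inside both neighbourhoods; the clamped
    argument below does reach its endpoints.\<close>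
  define \<delta> where "\<delta> = min \<epsilon> \<epsilon>' / 2"
  have \<delta>: "0 < \<delta>" "\<delta> < \<epsilon>" "\<delta> < \<epsilon>'" using \<open>0 < \<epsilon>\<close> \<open>0 < \<epsilon>'\<close> by (auto simp: \<delta>_def)
  define g where "g x = (if x = 0 then 1 else \<kappa> * x / X x)" for x
  define p where "p x = g (max (- \<delta>) (min \<delta> x))" for x
  have quot: "1 / 2 < X x / (\<kappa> * x)" "X x / (\<kappa> * x) < 2" if "x \<noteq> 0" "\<bar>x\<bar> \<le> \<delta>" for x
  proof -
    have "\<bar>X x / (\<kappa> * x) - 1\<bar> < 1 / 2" using that \<delta> by (intro close) auto
    then show "1 / 2 < X x / (\<kappa> * x)" "X x / (\<kappa> * x) < 2" by linarith+
  qed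
  have nz: "X x \<noteq> 0" if "x \<noteq> 0" "\<bar>x\<bar> \<le> \<delta>" for x
    using quot(1)[OF that] by auto
  have g_bounds: "1 / 2 \<le> g x" "g x \<le> 2" if "\<bar>x\<bar> \<le> \<delta>" for x
  proof -
    have "inverse 2 \<le> inverse (X x / (\<kappa> * x))" "inverse (X x / (\<kappa> * x)) \<le> inverse (1 / 2)"
      if "x \<noteq> 0"
      using quot[OF that \<open>\<bar>x\<bar> \<le> \<delta>\<close>] by (intro le_imp_inverse_le; linarith)+
    then show "1 / 2 \<le> g x" "g x \<le> 2" by (simp_all add: g_def)
  qed
  have g_cont: "isCont g x" if "\<bar>x\<bar> \<le> \<delta>" for x
  proof -
    have "((\<lambda>x. \<kappa> * x / X x) \<longlongrightarrow> 1) (at 0)" using tendsto_inverse[OF lim] by simp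
    then show ?thesis unfolding g_def[abs_def]
    proof (rule isCont_if_zero)
      assume "x \<noteq> 0"
      then show "isCont (\<lambda>x. \<kappa> * x / X x) x"
        using nz[of x] that \<delta> by (intro continuous_intros DERIV_isCont[OF dX]) auto
    qed
  qed
  have clamp: "\<bar>max (- \<delta>) (min \<delta> x)\<bar> \<le> \<delta>" for x using \<delta> by (auto simp: abs_le_iff)
  have p_cont: "isCont p x" for x
    unfolding p_def by (intro isCont_o2[OF _ g_cont] clamp continuous_intros)
  have X: "X x = multiplier X * x / p x" if "\<bar>x\<bar> < \<delta>" for x
  proof -
    have "max (- \<delta>) (min \<delta> x) = x" using that by (auto simp: abs_less_iff)
    then show ?thesis using nz[of x] that \<open>X 0 = 0\<close> \<open>\<kappa> \<noteq> 0\<close> by (auto simp: p_def g_def \<kappa>_def)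
  qed
  show ?thesis
  proof (rule that[of \<delta> X' p])
    show "continuous_on {-\<delta><..<\<delta>} X'" by (rule continuous_on_subset[OF X'_cont]) (use \<delta> in auto)
  qed (use \<delta> dX X p_cont g_bounds clamp in \<open>auto simp: p_def g_def\<close>)
qed

text \<open>The field and its explicit derivative \<open>D\<close> are jointly continuous in
  parameter and point on a compact box, which yields uniform convergence of both.\<close>

lemma C1_continuous_path_perturbation:
  assumes "0 < \<delta>" "continuous_on {-\<delta><..<\<delta>} X'"
    and dX: "\<And>x. \<bar>x\<bar> < \<delta> \<Longrightarrow> (X has_real_derivative X' x) (at x)"
    and X: "\<And>x. \<bar>x\<bar> < \<delta> \<Longrightarrow> X x = \<kappa> * x / p x" and "\<kappa> \<noteq> 0"
    and p: "\<And>x. isCont p x" "p 0 = 1" "\<And>x. 1 / 2 \<le> p x"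
  shows "C1_continuous_path {0..1} (\<lambda>\<alpha> x. \<kappa> * x / (p x + \<alpha> * log_osc' x))"
proof -
  define Y where "Y \<alpha> x = \<kappa> * x / (p x + \<alpha> * log_osc' x)" for \<alpha> x
  define D where "D \<alpha> x = ((p x)\<^sup>2 * X' x - \<alpha> * \<kappa> * log_osc'' x) / (p x + \<alpha> * log_osc' x)\<^sup>2" for \<alpha> x
  \<comment> \<open>Continuity of \<open>X'\<close> is known only on the open interval, hence the
    compact interval of half the size.\<close>
  let ?I = "{0..1::real}" and ?S = "{-(\<delta> / 2)..\<delta> / 2}"
  have pos: "p x + \<alpha> * log_osc' x \<noteq> 0" if "\<alpha> \<in> ?I" for \<alpha> x
  proof -
    have "\<bar>\<alpha> * log_osc' x\<bar> \<le> 1 * (1 / 4)"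
      unfolding abs_mult using that abs_log_osc'_le by (intro mult_mono) auto
    then show ?thesis using p(3)[of x] by (auto simp: abs_le_iff)
  qed
  have deriv: "(Y \<alpha> has_real_derivative D \<alpha> x) (at x)" if "\<alpha> \<in> ?I" "x \<in> ?S" for \<alpha> x
    unfolding Y_def D_def
    by (rule perturbed_field_deriv[of \<delta> X X' \<kappa> p \<alpha> x, OF dX X \<open>\<kappa> \<noteq> 0\<close> p])
      (use that \<open>0 < \<delta>\<close> in auto)
  have cont: "continuous_on A (\<lambda>z. f (g z))" if "\<And>x. isCont f x" "continuous_on A g"
    for f :: "real \<Rightarrow> real" and g :: "real \<times> real \<Rightarrow> real" and A
    by (rule continuous_on_compose2[of UNIV f, OF _ that(2)])
      (auto intro: continuous_at_imp_continuous_on that(1))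
  have X'_cont: "continuous_on (?I \<times> ?S) (\<lambda>z. X' (snd z))"
    by (rule continuous_on_compose2[OF assms(2) continuous_on_snd]) (use \<open>0 < \<delta>\<close> in auto)
  have Y_cont: "continuous_on (?I \<times> ?S) (\<lambda>z. Y (fst z) (snd z))"
    unfolding Y_def using pos by (intro continuous_intros cont[OF p(1)] cont[OF isCont_log_osc']) auto
  have D_cont: "continuous_on (?I \<times> ?S) (\<lambda>z. D (fst z) (snd z))"
    unfolding D_def using pos
    by (intro continuous_intros cont[OF p(1)] cont[OF isCont_log_osc'] cont[OF isCont_log_osc''] X'_cont) auto
  have "Y \<alpha> C1_differentiable_on ?S" if "\<alpha> \<in> ?I" for \<alpha>
    unfolding C1_differentiable_on_def
  proof (intro exI[of _ "D \<alpha>"] conjI ballI)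
    show "continuous_on ?S (D \<alpha>)"
      using continuous_on_compose2[OF D_cont, of ?S "\<lambda>x. (\<alpha>, x)"] that
      by (simp add: continuous_on_Pair image_subset_iff)
  qed (use deriv[OF that] in \<open>simp add: has_real_derivative_iff_has_vector_derivative\<close>)
  moreover have "uniform_limit ?S Y (Y \<alpha>) (at \<alpha> within ?I)" if "\<alpha> \<in> ?I" for \<alpha>
    by (rule uniform_limit_of_jointly_continuous[OF Y_cont compact_Icc that])
  moreover have "uniform_limit ?S (\<lambda>\<beta>. deriv (Y \<beta>)) (deriv (Y \<alpha>)) (at \<alpha> within ?I)"
    if "\<alpha> \<in> ?I" for \<alpha>
  proof -
    have eq: "deriv (Y \<beta>) x = D \<beta> x" if "\<beta> \<in> ?I" "x \<in> ?S" for \<beta> x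
      using DERIV_imp_deriv[OF deriv[OF that]] .
    have "\<forall>\<^sub>F \<beta> in at \<alpha> within ?I. \<forall>x\<in>?S. D \<beta> x = deriv (Y \<beta>) x"
      by (auto simp: eventually_at_filter eq)
    then have "uniform_limit ?S D (D \<alpha>) (at \<alpha> within ?I) \<longleftrightarrow>
        uniform_limit ?S (\<lambda>\<beta>. deriv (Y \<beta>)) (deriv (Y \<alpha>)) (at \<alpha> within ?I)"
      by (rule uniform_limit_cong) (rule eq[OF that, symmetric])
    then show ?thesis
      using uniform_limit_of_jointly_continuous[OF D_cont compact_Icc that] by blast
  qed
  moreover have "\<exists>a\<in>?I. \<exists>b\<in>?I. a < b"
    by (rule bexI[of _ 0], rule bexI[of _ 1]) auto
  ultimately show ?thesis
    unfolding C1_continuous_path_def Y_def[abs_def, symmetric]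
    using \<open>0 < \<delta>\<close> by (intro conjI exI[of _ "\<delta> / 2"]) (auto simp: is_interval_cc)
qed

theorem theoremB:
  fixes X\<^sub>0 :: "real \<Rightarrow> real"
  assumes "hyperbolic_germ X\<^sub>0"
  shows "\<exists>(I :: real set) (X :: real \<Rightarrow> real \<Rightarrow> real) (F :: real \<Rightarrow> real \<Rightarrow> real).
           C1_continuous_path I X \<and>
           (\<forall>\<alpha>\<in>I. hyperbolic_germ (X \<alpha>) \<and> multiplier (X \<alpha>) = multiplier X\<^sub>0) \<and>
           (\<exists>\<alpha>\<in>I. \<forall>\<^sub>F x in nhds 0. X \<alpha> x = X\<^sub>0 x) \<and>
           (\<forall>\<alpha>\<in>I. is_time_one_map (X \<alpha>) (F \<alpha>)) \<and>
           (\<forall>\<alpha>\<in>I. \<forall>\<beta>\<in>I. \<alpha> \<noteq> \<beta> \<longrightarrow>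
              bilipschitz_conjugate (F \<alpha>) (F \<beta>) \<and> \<not> C1_conjugate (F \<alpha>) (F \<beta>))"
proof -
  define \<kappa> where "\<kappa> = multiplier X\<^sub>0"
  have "\<kappa> \<noteq> 0" using assms by (simp add: hyperbolic_germ_def \<kappa>_def)
  obtain X' p \<delta> where \<delta>: "0 < \<delta>" and X'_cont: "continuous_on {-\<delta><..<\<delta>} X'"
    and dX: "\<And>x. \<bar>x\<bar> < \<delta> \<Longrightarrow> (X\<^sub>0 has_real_derivative X' x) (at x)"
    and X\<^sub>0: "\<And>x. \<bar>x\<bar> < \<delta> \<Longrightarrow> X\<^sub>0 x = \<kappa> * x / p x"
    and p: "\<And>x. isCont p x" "p 0 = 1" "\<And>x. 1 / 2 \<le> p x" "\<And>x. p x \<le> 2"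
    using hyperbolic_germ_normal_form[OF assms] unfolding \<kappa>_def by metis
  obtain L where L: "\<And>x. x \<noteq> 0 \<Longrightarrow> (L has_real_derivative p x / x) (at x)"
    using exists_time_coordinate[OF p(1)] by blast
  \<comment> \<open>Parameter 0 gives back the original germ, and \<open>|\<alpha>| \<le> 1\<close>
    is the range allowed by the perturbation bounds.\<close>
  define I where "I = {0..1::real}"
  define P where "P \<alpha> x = p x + \<alpha> * log_osc' x" for \<alpha> x
  define X where "X \<alpha> x = \<kappa> * x / P \<alpha> x" for \<alpha> x
  define T where "T \<alpha> x = L x + \<alpha> * osc (ln \<bar>x\<bar>)" for \<alpha> x
  define F where "F \<alpha> = time_shift (T \<alpha>) \<kappa>" for \<alpha>
  have tc: "time_coordinate (P \<alpha>) (T \<alpha>) (1 / 4) (9 / 4)" if "\<alpha> \<in> I" for \<alpha>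
    unfolding P_def T_def by (rule time_coordinate_perturbation[OF p _ L]) (use that in \<open>auto simp: I_def\<close>)
  have path: "C1_continuous_path I X"
    unfolding I_def X_def P_def
    by (rule C1_continuous_path_perturbation[OF \<delta> X'_cont dX X\<^sub>0 \<open>\<kappa> \<noteq> 0\<close> p(1-3)])
  \<comment> \<open>The perturbed denominator still tends to 1, so the difference quotient of the
    field at 0 tends to \<open>\<kappa>\<close> for every parameter.\<close>
  have mult: "multiplier (X \<alpha>) = \<kappa>" for \<alpha>
  proof -
    have "isCont (P \<alpha>) 0"
      unfolding P_def by (intro continuous_intros p(1) isCont_log_osc')
    moreover have "P \<alpha> 0 = 1" by (simp add: P_def p log_osc'_def)
    ultimately have "(P \<alpha> \<longlongrightarrow> 1) (at 0)" by (simp add: isCont_def)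
    then have "((\<lambda>x. \<kappa> / P \<alpha> x) \<longlongrightarrow> \<kappa> / 1) (at 0)" by (intro tendsto_intros) auto
    then have "((\<lambda>x. (X \<alpha> x - X \<alpha> 0) / (x - 0)) \<longlongrightarrow> \<kappa>) (at 0)"
      unfolding div_by_1
      by (rule Lim_transform_eventually) (simp add: X_def eventually_at_filter)
    then show ?thesis
      unfolding multiplier_def by (intro DERIV_imp_deriv) (simp add: has_field_derivative_iff)
  qed
  have hyp: "hyperbolic_germ (X \<alpha>)" if \<alpha>: "\<alpha> \<in> I" for \<alpha>
  proof -
    obtain d where "0 < d" "X \<alpha> C1_differentiable_on {-d..d}"
      using path \<alpha> unfolding C1_continuous_path_def by blast
    then have "X \<alpha> C1_differentiable_on {-d<..<d}" by (auto elim: C1_differentiable_on_subset)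
    then show ?thesis using \<open>0 < d\<close> \<open>\<kappa> \<noteq> 0\<close> mult[of \<alpha>]
      by (auto simp: hyperbolic_germ_def C1_vector_field_germ_def X_def)
  qed
  have "\<forall>\<^sub>F x in nhds 0. x \<in> {-\<delta><..<\<delta>}" using \<delta> by (intro eventually_nhds_in_open) auto
  then have start: "\<forall>\<^sub>F x in nhds 0. X 0 x = X\<^sub>0 x"
    by eventually_elim (auto simp: X_def P_def X\<^sub>0 abs_less_iff)
  have bilip: "bilipschitz_conjugate (F \<alpha>) (F \<beta>)" if "\<alpha> \<in> I" "\<beta> \<in> I" for \<alpha> \<beta>
    unfolding F_def
  proof (rule bilipschitz_conjugate_time_shifts[OF tc tc, OF that])
    fix x :: real
    \<comment> \<open>The base coordinate \<open>L\<close> cancels, so the two times differ by a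
      bounded function although neither is bounded near 0.\<close>
    have "\<bar>T \<alpha> x - T \<beta> x\<bar> = \<bar>\<alpha> - \<beta>\<bar> * \<bar>osc (ln \<bar>x\<bar>)\<bar>"
      by (simp add: T_def left_diff_distrib flip: abs_mult)
    also have "\<dots> \<le> 1 * (1 / 4)"
      using that abs_osc_le by (intro mult_mono) (auto simp: I_def)
    finally show "\<bar>T \<alpha> x - T \<beta> x\<bar> \<le> 1 / 4" by simp
  qed
  have "\<not> C1_conjugate (F \<alpha>) (F \<beta>)" if "\<alpha> \<in> I" "\<beta> \<in> I" "\<alpha> \<noteq> \<beta>" for \<alpha> \<beta>
    using not_C1_conjugate_perturbations[OF tc[OF that(1), unfolded T_def] tc[OF that(2), unfolded T_def]
        \<open>\<kappa> \<noteq> 0\<close> that(3)]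
    unfolding F_def T_def .
  moreover have "is_time_one_map (X \<alpha>) (F \<alpha>)" if "\<alpha> \<in> I" for \<alpha>
    unfolding F_def by (rule time_coordinate.is_time_one_map_time_shift[OF tc[OF that] X_def])
  moreover have "0 \<in> I" by (simp add: I_def)
  ultimately show ?thesis
    using path hyp mult start bilip unfolding \<kappa>_def[symmetric] by blast
qed

end
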